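(* Let $n\ge 2$ and let $\mathbf{X}$ be a random variable distributed with a radially symmetric probability density $f_\infty(|\mathbf{x}|)$, $\mathbf{x}\in\mathbb{R}^n$. Let $f(\rho)$, $\rho\in\mathbb{R}_+$, denote the one-dimensional probability density function $$f(\rho)=\sigma_n\,\rho^{n-1}f_\infty(\rho),$$ where $\sigma_n=2\pi^{n/2}/\Gamma(n/2)$ is the measure of the hyperspherical surface of unit radius in $\mathbb{R}^n$. If the non-negative random variable $X$ distributed with probability density $f(\rho)$ satisfies the one-dimensional Poincaré inequality on $I=(0,+\infty)$ with weight $w(\rho)$, then for any smooth scalar function $\phi(\mathbf{x})$ on $\mathbb{R}^n$ such that $Var(\phi(\mathbf{X}))$ is finite it holds $$\int_{\mathbb{R}^n}\phi^2(\mathbf{x})f_\infty(|\mathbf{x}|)\,d\mathbf{x}-\left(\int_{\mathbb{R}^n}\phi(\mathbf{y})f_\infty(|\mathbf{y}|)\,d\mathbf{y}\right)^2\le\int_{\mathbb{R}^n}W_*(|\mathbf{x}|)\,|\nabla\phi(\mathbf{x})|^2 f_\infty(|\mathbf{x}|)\,d\mathbf{x},$$ where $$W_*(|\mathbf{x}|)=\max\left\{w(|\mathbf{x}|),\frac{\pi^2}{2}|\mathbf{x}|^2\right\}.$$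
   Context: A random variable $X$ distributed with probability density $g$ on an interval $I\subseteq\mathbb{R}$ is said to satisfy the one-dimensional (weighted) Poincaré inequality on $I$ with weight $w$, where $w$ is a fixed nonnegative Borel measurable function on $I$, if for any bounded smooth scalar function $\varphi$ on $I$ $$\int_I\left(\varphi(x)-\int_I\varphi(y)g(y)\,dy\right)^2 g(x)\,dx\le\int_I w(x)\,(\varphi'(x))^2 g(x)\,dx .$$ All these inequalities are understood in the following sense: if the right-hand side is finite, then the inequality holds. Here $\Gamma$ is the Euler Gamma function and $Var(\phi(\mathbf{X}))=\int_{\mathbb{R}^n}\left(\phi(\mathbf{x})-\int_{\mathbb{R}^n}\phi(\mathbf{y})f_\infty(|\mathbf{y}|)\,d\mathbf{y}\right)^2 f_\infty(|\mathbf{x}|)\,d\mathbf{x}$. *)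

theory Defs
  imports "HOL-Probability.Probability"
begin

text \<open>For an open set, or a nondegenerate interval of the real line, the derivative within
  \<open>S\<close> is unique, so \<^term>\<open>frechet_derivative\<close> is the derivative.\<close>

fun Ck_on :: "nat \<Rightarrow> 'a::real_normed_vector set \<Rightarrow> ('a \<Rightarrow> real) \<Rightarrow> bool" where
  "Ck_on 0 S f \<longleftrightarrow> continuous_on S f"
| "Ck_on (Suc k) S f \<longleftrightarrow>
     f differentiable_on S \<and> (\<forall>v. Ck_on k S (\<lambda>x. frechet_derivative f (at x within S) v))"

definition smooth_on :: "'a::real_normed_vector set \<Rightarrow> ('a \<Rightarrow> real) \<Rightarrow> bool" where
  "smooth_on S f \<longleftrightarrow> (\<forall>k. Ck_on k S f)"

definition gradient :: "('a::real_inner \<Rightarrow> real) \<Rightarrow> 'a \<Rightarrow> 'a" where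
  "gradient f x = (THE D. GDERIV f x :> D)"

text \<open>The two sides of the inequality are integrals of nonnegative functions and are compared
  as extended nonnegative numbers: an infinite right-hand side imposes nothing. The value of
  \<^term>\<open>deriv \<phi>\<close> at an endpoint of \<open>I\<close> does not matter, since endpoints form a null set.\<close>

definition weighted_poincare ::
  "'a measure \<Rightarrow> ('a \<Rightarrow> real) \<Rightarrow> (real \<Rightarrow> real) \<Rightarrow> real set \<Rightarrow> (real \<Rightarrow> real) \<Rightarrow> bool" where
  "weighted_poincare M X g I w \<longleftrightarrow>
     distributed M lborel X (\<lambda>x. ennreal (g x) * indicator I x) \<and>
     (\<forall>\<phi>. smooth_on I \<phi> \<and> bounded (\<phi> ` I) \<longrightarrow>
        (\<integral>\<^sup>+x\<in>I. ennreal ((\<phi> x - (LINT y:I|lborel. \<phi> y * g y))\<^sup>2 * g x) \<partial>lborel)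
          \<le> (\<integral>\<^sup>+x\<in>I. ennreal (w x * (deriv \<phi> x)\<^sup>2 * g x) \<partial>lborel))"

definition unit_sphere_area :: "nat \<Rightarrow> real" where
  "unit_sphere_area n = 2 * pi powr (real n / 2) / Gamma (real n / 2)"

definition radial_density :: "nat \<Rightarrow> (real \<Rightarrow> real) \<Rightarrow> real \<Rightarrow> real" where
  "radial_density n p \<rho> = unit_sphere_area n * \<rho> ^ (n - 1) * p \<rho>"

end

theory Submission
  imports Defs
begin

text \<open>Write \<open>X = R \<theta>\<close> with \<open>R = |X|\<close> and \<open>\<theta>\<close> on the unit sphere. Radial symmetry makes \<open>R\<close> and
  \<open>\<theta>\<close> independent, with \<open>R\<close> of density \<open>f\<close> and \<open>\<theta>\<close> uniform. For a function of two independent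
  variables, the Efron-Stein inequality (\<open>efron_stein_pair\<close>) bounds the variance by the sum of the two
  mean conditional variances. With \<open>\<theta>\<close> fixed, the function lives on a ray, and the one-dimensional
  inequality bounds its variance by the mean of \<open>w(R) (\<theta> \<bullet> \<nabla>\<phi>)\<^sup>2\<close> (\<open>poincare_on_ray\<close>). With \<open>R\<close>
  fixed, it lives on a sphere of radius \<open>R\<close>, and a Poincare inequality on the sphere bounds its
  variance by the mean of \<open>(\<pi>\<^sup>2/2) R\<^sup>2 (|\<nabla>\<phi>|\<^sup>2 - (\<theta> \<bullet> \<nabla>\<phi>)\<^sup>2)\<close> (\<open>sphere_poincare\<close>). The radial and the
  tangential part of the gradient then share the weight \<open>max {w(R), (\<pi>\<^sup>2/2) R\<^sup>2}\<close>
  (\<open>variance_radial_le\<close>).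

  A uniform direction is represented as \<open>sgn z = z/|z|\<close> with \<open>z\<close> a Gaussian vector, so that no
  surface measure is involved: polar coordinates become a statement about Lebesgue measure that Fubini's
  theorem and scaling prove (\<open>nn_integral_polar\<close>).

  The Gaussian model also yields the inequality on the sphere. For independent Gaussian vectors \<open>u\<close>,
  \<open>v\<close>, the variance is half the mean of \<open>(\<psi>(sgn u) - \<psi>(sgn v))\<^sup>2\<close>. The pair \<open>(u, v)\<close> has the law of
  the two ends of the arc \<open>\<gamma>(s) = cos s y + sin s x\<close>, \<open>-\<pi>/4 \<le> s \<le> \<pi>/4\<close>, with \<open>x\<close>, \<open>y\<close> again
  independent Gaussian vectors. The projection of this arc to the sphere has length at most \<open>\<pi>\<close>, so by
  the Cauchy-Schwarz inequality the squared increment is at most \<open>\<pi>\<close> times the tangential energy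
  along the arc, taken with respect to arc length. As \<open>(x, y)\<close> is invariant under rotations, each
  \<open>s\<close> contributes the same mean energy, and the range of \<open>s\<close> has length \<open>\<pi>/2\<close>. The speed of the
  projected arc at \<open>s = 0\<close> is at most \<open>|x|/|y|\<close>, where \<open>|y|\<close> is independent of \<open>sgn y\<close>, and
  \<open>E|x| E(1/|y|) \<le> n/(n - 1) \<le> 2\<close>. Altogether the constant is \<open>(1/2) \<pi> (\<pi>/2) 2 = \<pi>\<^sup>2/2\<close>.

  The one-dimensional inequality speaks about bounded functions only. It is applied to
  \<open>k sin(\<phi>/k)\<close>, which is smooth and bounded, has a gradient no longer than that of \<open>\<phi>\<close>, and is dominated
  by \<open>|\<phi>|\<close>; the limit \<open>k \<rightarrow> \<infinity>\<close> gives the result for \<open>\<phi>\<close>.\<close>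

section \<open>Polar coordinates\<close>

lemma nn_integral_lborel_scaleR:
  fixes F :: "'a::euclidean_space \<Rightarrow> ennreal"
  assumes [measurable]: "F \<in> borel_measurable borel" and c: "c \<noteq> 0"
  shows "(\<integral>\<^sup>+x. F x \<partial>lborel) = ennreal (\<bar>c\<bar> ^ DIM('a)) * (\<integral>\<^sup>+x. F (c *\<^sub>R x) \<partial>lborel)"
proof -
  have "(\<integral>\<^sup>+x. F x \<partial>lborel)
      = (\<integral>\<^sup>+x. F x \<partial>density (distr lborel borel (\<lambda>x. 0 + c *\<^sub>R x)) (\<lambda>_. \<bar>c\<bar> ^ DIM('a)))"
    using lborel_affine[OF c, of "0::'a"] by simp
  then show ?thesis
    by (simp add: nn_integral_density nn_integral_distr nn_integral_cmult)
qed

lemma nn_integral_lborel_translate: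
  fixes F :: "'a::euclidean_space \<Rightarrow> ennreal"
  assumes [measurable]: "F \<in> borel_measurable borel"
  shows "(\<integral>\<^sup>+x. F (a + x) \<partial>lborel) = (\<integral>\<^sup>+x. F x \<partial>lborel)"
proof -
  have "(\<integral>\<^sup>+x. F x \<partial>lborel) = (\<integral>\<^sup>+x. F x \<partial>distr lborel borel ((+) a))"
    by (simp add: lborel_distr_plus)
  then show ?thesis by (simp add: nn_integral_distr)
qed

lemma nn_integral_power_tail:
  fixes a :: real
  assumes a: "0 < a" and n: "0 < n"
  shows "(\<integral>\<^sup>+s. ennreal (1 / s ^ Suc n) * indicator {a<..} s \<partial>lborel) = ennreal (1 / (n * a ^ n))"
proof -
  have "(\<integral>\<^sup>+s. ennreal (1 / s ^ Suc n) * indicator {a<..} s \<partial>lborel)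
      = (\<integral>\<^sup>+s. ennreal (1 / s ^ Suc n) * indicator {a..} s \<partial>lborel)"
    by (rule nn_integral_cong_AE) (use AE_lborel_singleton[of a] in \<open>auto split: split_indicator\<close>)
  also have "\<dots> = ennreal (0 - (- 1 / (n * a ^ n)))"
  proof (rule nn_integral_FTC_atLeast)
    fix x assume "a \<le> x"
    then have x: "x > 0" using a by simp
    have "((\<lambda>s. - (inverse (real n) * inverse (s ^ n))) has_real_derivative
        - (inverse (real n) * (- (inverse (x ^ n) * (real n * x ^ (n - Suc 0)) * inverse (x ^ n))))) (at x)"
      using x by (auto intro!: derivative_eq_intros)
    also have "- (inverse (real n) * (- (inverse (x ^ n) * (real n * x ^ (n - Suc 0)) * inverse (x ^ n)))) 
        = (real n * inverse (real n)) * (x ^ (n - 1) * inverse (x ^ n) * inverse (x ^ n))"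
      by simp
    also have "\<dots> = 1 / x ^ Suc n"
      using x n by (cases n) (auto simp: field_simps simp del: of_nat_Suc)
    finally show "((\<lambda>s::real. - 1 / (n * s ^ n)) has_real_derivative 1 / x ^ Suc n) (at x)"
      by (simp add: field_simps)
    show "0 \<le> 1 / x ^ Suc n" using x by simp
  next
    have "((\<lambda>s. - (1 / real n) * (inverse s) ^ n) \<longlongrightarrow> - (1 / real n) * 0 ^ n) at_top"
      by (intro tendsto_intros tendsto_inverse_0_at_top filterlim_ident)
    then show "((\<lambda>s::real. - 1 / (n * s ^ n)) \<longlongrightarrow> 0) at_top"
      using n by (simp add: field_simps power_inverse zero_power)
  qed simp
  finally show ?thesis by simp
qed

lemma sgn_scaleR_sgn: "0 < r \<Longrightarrow> sgn (r *\<^sub>R sgn z) = sgn (z :: 'a::real_normed_vector)"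
  by (cases "z = 0") (simp_all add: sgn_div_norm field_simps)

text \<open>The integral \<open>n \<integral> s\<^sup>-\<^sup>n\<^sup>-\<^sup>1 ds\<close> over \<open>s > |x|\<close> equals \<open>|x|\<^sup>-\<^sup>n\<close>, so multiplying it by
  \<open>|x|\<^sup>n\<close> inserts a factor \<open>1\<close> under \<open>\<integral> F\<close>. For fixed \<open>s\<close>, the substitution \<open>x = s z\<close> turns the
  region \<open>|x| < s\<close> into the unit ball; for fixed \<open>z\<close>, the substitution \<open>\<rho> = s |z|\<close> turns \<open>s z\<close> into
  \<open>\<rho> sgn z\<close>. All powers of \<open>s\<close> and \<open>|z|\<close> cancel except \<open>\<rho>\<^sup>n\<^sup>-\<^sup>1\<close>.\<close>

theorem nn_integral_polar:
  fixes F :: "'a::euclidean_space \<Rightarrow> ennreal"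
  assumes [measurable]: "F \<in> borel_measurable borel"
  shows "(\<integral>\<^sup>+x. F x \<partial>lborel) =
    (\<integral>\<^sup>+\<rho>. ennreal (DIM('a) * \<rho> ^ (DIM('a) - 1)) * indicator {0<..} \<rho> *
        (\<integral>\<^sup>+z. F (\<rho> *\<^sub>R sgn z) * indicator (ball 0 1) z \<partial>lborel) \<partial>lborel)" (is "_ = ?R")
proof -
  let ?n = "DIM('a)"
  have n: "?n > 0" by simp
  have [measurable]: "ball (0::'a) 1 \<in> sets borel" by simp
  have nz: "AE z in lborel. z \<noteq> (0::'a)" by (rule AE_lborel_singleton)
  have [measurable]: "(sgn :: 'a \<Rightarrow> 'a) \<in> borel_measurable borel"
    unfolding sgn_div_norm by measurable
  have *: "ennreal (x ^ ?n) * (ennreal ?n * ennreal (1 / (?n * x ^ ?n))) = 1" if "x > 0" for x :: real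
    using that n by (simp add: ennreal_mult'[symmetric])
  have "(\<integral>\<^sup>+x. F x \<partial>lborel) = (\<integral>\<^sup>+x. F x * (ennreal (norm x ^ ?n) * (ennreal ?n *
        (\<integral>\<^sup>+s. ennreal (1 / s ^ Suc ?n) * indicator {norm x<..} s \<partial>lborel))) \<partial>lborel)"
    by (intro nn_integral_cong_AE, use nz in eventually_elim)
       (subst nn_integral_power_tail, auto simp: * simp del: power_Suc)
  also have "\<dots> = (\<integral>\<^sup>+x. (\<integral>\<^sup>+s. F x * ennreal (?n * norm x ^ ?n / s ^ Suc ?n) * indicator {norm x<..} s \<partial>lborel) \<partial>lborel)"
    apply (intro nn_integral_cong)
    apply (subst nn_integral_cmult[symmetric], measurable)+
    apply (intro nn_integral_cong)
    apply (auto simp: ennreal_mult'[symmetric] mult_ac split: split_indicator simp del: power_Suc)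
    done
  also have "\<dots> = (\<integral>\<^sup>+s. (\<integral>\<^sup>+x. F x * ennreal (?n * norm x ^ ?n / s ^ Suc ?n) * indicator {norm x<..} s \<partial>lborel) \<partial>lborel)"
    by (rule lborel_pair.Fubini') (simp add: case_prod_beta greaterThan_def)
  also have "\<dots> = (\<integral>\<^sup>+s. (\<integral>\<^sup>+z. indicator {0<..} s * F (s *\<^sub>R z) * ennreal (?n * norm z ^ ?n * s ^ (?n - 1)) * indicator (ball 0 1) z \<partial>lborel) \<partial>lborel)"
  proof (rule nn_integral_cong)
    fix s :: real
    show "(\<integral>\<^sup>+x. F x * ennreal (?n * norm x ^ ?n / s ^ Suc ?n) * indicator {norm x<..} s \<partial>lborel) =
      (\<integral>\<^sup>+z. indicator {0<..} s * F (s *\<^sub>R z) * ennreal (?n * norm z ^ ?n * s ^ (?n - 1)) * indicator (ball 0 1) z \<partial>lborel)"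
    proof (cases "s > 0")
      case True
      have e: "s ^ ?n * (?n * (s * norm z) ^ ?n / s ^ Suc ?n) = ?n * norm z ^ ?n * s ^ (?n - 1)" for z :: 'a
        using True n by (cases ?n) (auto simp: field_simps)
      have e': "ennreal (?n * norm (s *\<^sub>R z) ^ ?n / s ^ Suc ?n) * ennreal (s ^ ?n)
          = ennreal (?n * norm z ^ ?n * s ^ (?n - 1))" for z :: 'a
        unfolding e[symmetric] using True
        by (subst ennreal_mult'[symmetric]) (simp_all add: mult.commute[of "s ^ ?n"] del: power_Suc)
      have "(\<integral>\<^sup>+x. F x * ennreal (?n * norm x ^ ?n / s ^ Suc ?n) * indicator {norm x<..} s \<partial>lborel)
          = ennreal (\<bar>s\<bar> ^ ?n) * (\<integral>\<^sup>+z. F (s *\<^sub>R z) * ennreal (?n * norm (s *\<^sub>R z) ^ ?n / s ^ Suc ?n)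
              * indicator {norm (s *\<^sub>R z)<..} s \<partial>lborel)"
        using True by (intro nn_integral_lborel_scaleR) (simp_all add: greaterThan_def)
      also have "\<dots> = (\<integral>\<^sup>+z. ennreal (\<bar>s\<bar> ^ ?n) * (F (s *\<^sub>R z) * ennreal (?n * norm (s *\<^sub>R z) ^ ?n / s ^ Suc ?n)
              * indicator {norm (s *\<^sub>R z)<..} s) \<partial>lborel)"
        by (rule nn_integral_cmult[symmetric]) (simp add: greaterThan_def)
      also have "\<dots> = (\<integral>\<^sup>+z. indicator {0<..} s * F (s *\<^sub>R z) * ennreal (?n * norm z ^ ?n * s ^ (?n - 1)) * indicator (ball 0 1) z \<partial>lborel)"
      proof (intro nn_integral_cong)
        fix z :: 'a
        show "ennreal (\<bar>s\<bar> ^ ?n) * (F (s *\<^sub>R z) * ennreal (?n * norm (s *\<^sub>R z) ^ ?n / s ^ Suc ?n)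
              * indicator {norm (s *\<^sub>R z)<..} s)
            = indicator {0<..} s * F (s *\<^sub>R z) * ennreal (?n * norm z ^ ?n * s ^ (?n - 1)) * indicator (ball 0 1) z"
          unfolding e'[symmetric] using True by (cases "norm z < 1") (simp_all add: mult_ac del: power_Suc)
      qed
      finally show ?thesis .
    next
      case False
      then have "s \<notin> {norm x<..}" for x :: 'a
        using norm_ge_zero[of x] by (auto simp del: norm_ge_zero)
      then have "(\<integral>\<^sup>+x. F (x::'a) * ennreal (?n * norm x ^ ?n / s ^ Suc ?n) * indicator {norm x<..} s \<partial>lborel) = 0"
        by simp
      moreover have "indicator {0<..} s = (0::ennreal)" using False by simp
      ultimately show ?thesis by simp
    qed
  qed
  also have "\<dots> = (\<integral>\<^sup>+z. (\<integral>\<^sup>+s. indicator {0<..} s * F (s *\<^sub>R z) * ennreal (?n * norm z ^ ?n * s ^ (?n - 1)) * indicator (ball 0 1) z \<partial>lborel) \<partial>lborel)"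
    by (rule lborel_pair.Fubini') (simp add: case_prod_beta)
  also have "\<dots> = (\<integral>\<^sup>+z. (\<integral>\<^sup>+\<rho>. indicator {0<..} \<rho> * F (\<rho> *\<^sub>R sgn z) * ennreal (?n * \<rho> ^ (?n - 1)) * indicator (ball 0 1) z \<partial>lborel) \<partial>lborel)"
  proof (intro nn_integral_cong_AE, use nz in eventually_elim)
    fix z :: 'a assume z: "z \<noteq> 0"
    have e: "norm z * (?n * (norm z * s) ^ (?n - 1)) = ?n * norm z ^ ?n * s ^ (?n - 1)" for s
      using n by (cases ?n) (auto simp: field_simps)
    have e': "ennreal (norm z) * ennreal (?n * (norm z * s) ^ (?n - 1)) = ennreal (?n * norm z ^ ?n * s ^ (?n - 1))" for s
      unfolding e[symmetric] by (subst ennreal_mult') simp_all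
    have zz: "norm z *\<^sub>R sgn z = z" by (simp add: sgn_div_norm z)
    have zs: "(norm z * s) *\<^sub>R sgn z = s *\<^sub>R z" for s
      using zz by (metis mult.commute scaleR_scaleR)
    show "(\<integral>\<^sup>+s. indicator {0<..} s * F (s *\<^sub>R z) * ennreal (?n * norm z ^ ?n * s ^ (?n - 1)) * indicator (ball 0 1) z \<partial>lborel) =
       (\<integral>\<^sup>+\<rho>. indicator {0<..} \<rho> * F (\<rho> *\<^sub>R sgn z) * ennreal (?n * \<rho> ^ (?n - 1)) * indicator (ball 0 1) z \<partial>lborel)"
      apply (subst (2) nn_integral_real_affine[where t=0 and c="norm z"])
        apply measurable
       apply (simp add: z)
      apply (subst nn_integral_cmult[symmetric])
       apply measurable
      apply (rule nn_integral_cong)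
      subgoal for s
        unfolding e'[symmetric] zs[symmetric]
        using z by (cases "0 < s") (simp_all add: zero_less_mult_iff mult_ac)
      done
  qed
  also have "\<dots> = (\<integral>\<^sup>+\<rho>. (\<integral>\<^sup>+z. indicator {0<..} \<rho> * F (\<rho> *\<^sub>R sgn z) * ennreal (?n * \<rho> ^ (?n - 1)) * indicator (ball 0 1) z \<partial>lborel) \<partial>lborel)"
    by (rule lborel_pair.Fubini') (simp add: case_prod_beta)
  also have "\<dots> = ?R"
    by (intro nn_integral_cong, subst nn_integral_cmult[symmetric]) (auto simp: mult_ac intro!: nn_integral_cong)
  finally show ?thesis .
qed

lemma borel_measurable_sgn_vector [measurable]:
  "(sgn :: 'a::euclidean_space \<Rightarrow> 'a) \<in> borel_measurable borel"
  unfolding sgn_div_norm by measurable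

text \<open>Length and direction separate in polar coordinates; the directional factor is the same for
  every radial weight, which is why any of them, in particular a Gaussian one, can be used to average over
  directions.\<close>

lemma nn_integral_radial:
  fixes q :: "'a::euclidean_space \<Rightarrow> ennreal"
  assumes [measurable]: "k \<in> borel_measurable borel" "q \<in> borel_measurable borel"
  shows "(\<integral>\<^sup>+x. k (norm x) * q (sgn x) \<partial>lborel) =
    ennreal DIM('a) * (\<integral>\<^sup>+\<rho>. ennreal (\<rho> ^ (DIM('a) - 1)) * indicator {0<..} \<rho> * k \<rho> \<partial>lborel)
      * (\<integral>\<^sup>+z. q (sgn z) * indicator (ball 0 1) z \<partial>lborel)"
proof -
  let ?n = "DIM('a)"
  let ?\<beta> = "\<integral>\<^sup>+z. q (sgn z) * indicator (ball 0 1) z \<partial>lborel"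
  have nz: "AE z in lborel. z \<noteq> (0::'a)" by (rule AE_lborel_singleton)
  have [measurable]: "ball (0::'a) 1 \<in> sets borel" by simp
  have "(\<integral>\<^sup>+x. k (norm x) * q (sgn x) \<partial>lborel) =
    (\<integral>\<^sup>+\<rho>. ennreal (?n * \<rho> ^ (?n - 1)) * indicator {0<..} \<rho> *
        (\<integral>\<^sup>+z. k (norm (\<rho> *\<^sub>R sgn z)) * q (sgn (\<rho> *\<^sub>R sgn z)) * indicator (ball 0 1) z \<partial>lborel) \<partial>lborel)"
    by (rule nn_integral_polar) measurable
  also have "\<dots> = (\<integral>\<^sup>+\<rho>. ennreal (?n * \<rho> ^ (?n - 1)) * indicator {0<..} \<rho> * (k \<rho> * ?\<beta>) \<partial>lborel)"
  proof (intro nn_integral_cong)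
    fix \<rho> :: real
    show "ennreal (?n * \<rho> ^ (?n - 1)) * indicator {0<..} \<rho> *
        (\<integral>\<^sup>+z. k (norm (\<rho> *\<^sub>R sgn z)) * q (sgn (\<rho> *\<^sub>R sgn z)) * indicator (ball 0 1) z \<partial>lborel)
      = ennreal (?n * \<rho> ^ (?n - 1)) * indicator {0<..} \<rho> * (k \<rho> * ?\<beta>)"
    proof (cases "\<rho> > 0")
      case True
      have "(\<integral>\<^sup>+z. k (norm (\<rho> *\<^sub>R sgn z)) * q (sgn (\<rho> *\<^sub>R sgn z)) * indicator (ball 0 1) z \<partial>lborel)
          = (\<integral>\<^sup>+z. k \<rho> * (q (sgn z) * indicator (ball 0 1) z) \<partial>lborel)"
        by (intro nn_integral_cong_AE, use nz in eventually_elim)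
           (use True in \<open>simp add: sgn_scaleR_sgn norm_sgn mult_ac\<close>)
      also have "\<dots> = k \<rho> * ?\<beta>"
        by (rule nn_integral_cmult) simp
      finally show ?thesis by simp
    qed simp
  qed
  also have "\<dots> = (\<integral>\<^sup>+\<rho>. (ennreal ?n * ?\<beta>) * (ennreal (\<rho> ^ (?n - 1)) * indicator {0<..} \<rho> * k \<rho>) \<partial>lborel)"
    by (intro nn_integral_cong) (simp add: ennreal_mult' mult_ac)
  also have "\<dots> = (ennreal ?n * ?\<beta>) * (\<integral>\<^sup>+\<rho>. ennreal (\<rho> ^ (?n - 1)) * indicator {0<..} \<rho> * k \<rho> \<partial>lborel)"
    by (rule nn_integral_cmult) measurable
  finally show ?thesis by (simp add: mult_ac)
qed

section \<open>Radial moments of the Gaussian\<close>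

definition gauss_moment :: "nat \<Rightarrow> ennreal" where
  "gauss_moment m = (\<integral>\<^sup>+r. ennreal (r ^ m * exp (- r\<^sup>2)) * indicator {0<..} r \<partial>lborel)"

lemma gauss_moment_eq:
  assumes "has_bochner_integral lborel (\<lambda>x::real. indicator {0..} x *\<^sub>R (exp (- x\<^sup>2) * x ^ m)) c"
  shows "gauss_moment m = ennreal c"
proof -
  have "gauss_moment m = (\<integral>\<^sup>+x. ennreal (indicator {0..} x *\<^sub>R (exp (- x\<^sup>2) * x ^ m)) \<partial>lborel)"
    unfolding gauss_moment_def
    by (rule nn_integral_cong_AE) (use AE_lborel_singleton[of "0::real"] in \<open>auto split: split_indicator simp: mult_ac\<close>)
  also have "\<dots> = ennreal (LINT x|lborel. indicator {0..} x *\<^sub>R (exp (- x\<^sup>2) * x ^ m))"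
    using assms by (intro nn_integral_eq_integral) (auto simp: has_bochner_integral_iff split: split_indicator)
  finally show ?thesis using assms by (simp add: has_bochner_integral_iff)
qed

lemma gauss_moment_even: "gauss_moment (2 * k) = ennreal ((sqrt pi / 2) * (fact (2 * k) / (2 ^ (2 * k) * fact k)))"
  by (rule gauss_moment_eq[OF gaussian_moment_even_pos])

lemma gauss_moment_odd: "gauss_moment (2 * k + 1) = ennreal (fact k / 2)"
  by (rule gauss_moment_eq[OF gaussian_moment_odd_pos])

text \<open>This is integration by parts for \<open>\<integral> r\<^sup>m exp(- r\<^sup>2) dr\<close> over \<open>r > 0\<close>, read off here from the
  closed forms.\<close>

lemma gauss_moment_Suc_Suc: "gauss_moment (Suc (Suc m)) = ennreal ((m + 1) / 2) * gauss_moment m"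
proof (cases "even m")
  case True
  then obtain k where k: "m = 2 * k" by (auto elim: evenE)
  have e: "Suc (Suc m) = 2 * Suc k" using k by simp
  have r: "(2 * K + 2) * (2 * K + 1) * a / (4 * p * ((K + 1) * b)) = (2 * K + 1) / 2 * (a / (p * b))"
    if "b > 0" "p > 0" "K \<ge> 0" for K a p b :: real
  proof -
    have "K + 1 \<noteq> 0" using that by simp
    then have "(2 * K + 2) / (K + 1) = 2" by (simp add: divide_simps)
    moreover have "(2 * K + 2) * (2 * K + 1) * a / (4 * p * ((K + 1) * b))
        = (2 * K + 2) / (K + 1) * ((2 * K + 1) * a / (4 * (p * b)))"
      by (simp add: mult_ac)
    ultimately show ?thesis using that(1,2) by (simp only:) (simp add: field_simps)
  qed
  have "gauss_moment (Suc (Suc m)) = gauss_moment (2 * Suc k)" "gauss_moment m = gauss_moment (2 * k)"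
    by (simp only: e, simp only: k)
  moreover have "fact (2 * Suc k) / (2 ^ (2 * Suc k) * fact (Suc k))
      = (real m + 1) / 2 * (fact (2 * k) / (2 ^ (2 * k) * fact k :: real))"
    using r[of "fact k" "2 ^ (2 * k)" "real k" "fact (2 * k)"] by (simp add: k algebra_simps)
  then have "sqrt pi / 2 * (fact (2 * Suc k) / (2 ^ (2 * Suc k) * fact (Suc k)))
      = (real m + 1) / 2 * (sqrt pi / 2 * (fact (2 * k) / (2 ^ (2 * k) * fact k)))"
    by (simp only: mult_ac)
  ultimately show ?thesis
    unfolding gauss_moment_even by (simp only: ennreal_mult'[symmetric]) (simp add: ennreal_mult'[symmetric])
next
  case False
  then obtain k where k: "m = 2 * k + 1" by (auto elim: oddE)
  have e: "Suc (Suc m) = 2 * Suc k + 1" using k by simp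
  have "gauss_moment (Suc (Suc m)) = gauss_moment (2 * Suc k + 1)" "gauss_moment m = gauss_moment (2 * k + 1)"
    by (simp only: e, simp only: k)
  then show ?thesis unfolding gauss_moment_odd
    by (simp add: ennreal_mult'[symmetric] k field_simps)
qed

lemma gauss_moment_pos: "gauss_moment m > 0" and gauss_moment_finite: "gauss_moment m < \<infinity>"
proof -
  have "gauss_moment m > 0 \<and> gauss_moment m < \<infinity>"
  proof (cases "even m")
    case True
    then obtain k where "m = 2 * k" by (auto elim: evenE)
    then show ?thesis by (simp only: gauss_moment_even) simp
  next
    case False
    then obtain k where "m = 2 * k + 1" by (auto elim: oddE)
    then show ?thesis by (simp only: gauss_moment_odd) simp
  qed
  then show "gauss_moment m > 0" "gauss_moment m < \<infinity>" by auto
qed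

lemma gauss_moment_log_convex: "(gauss_moment (Suc m))\<^sup>2 \<le> gauss_moment m * gauss_moment (Suc (Suc m))"
proof -
  let ?f = "\<lambda>r::real. ennreal (sqrt (r ^ m * exp (- r\<^sup>2))) * indicator {0<..} r"
  let ?g = "\<lambda>r::real. ennreal (r * sqrt (r ^ m * exp (- r\<^sup>2))) * indicator {0<..} r"
  have [simp]: "(ennreal a)\<^sup>2 = ennreal (a\<^sup>2)" if "a \<ge> 0" for a
    using that by (simp add: ennreal_power)
  have *: "gauss_moment (Suc m) = (\<integral>\<^sup>+r. ?f r * ?g r \<partial>lborel)"
    unfolding gauss_moment_def
    by (intro nn_integral_cong)
       (auto split: split_indicator simp: ennreal_mult'[symmetric] mult_ac)
  have "(\<integral>\<^sup>+r. ?f r * ?g r \<partial>lborel)\<^sup>2 \<le> (\<integral>\<^sup>+r. (?f r)\<^sup>2 \<partial>lborel) * (\<integral>\<^sup>+r. (?g r)\<^sup>2 \<partial>lborel)"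
    by (rule Cauchy_Schwarz_nn_integral) measurable
  also have "(\<integral>\<^sup>+r. (?f r)\<^sup>2 \<partial>lborel) = gauss_moment m"
    unfolding gauss_moment_def by (intro nn_integral_cong) (auto split: split_indicator)
  also have "(\<integral>\<^sup>+r. (?g r)\<^sup>2 \<partial>lborel) = gauss_moment (Suc (Suc m))"
    unfolding gauss_moment_def
    by (intro nn_integral_cong)
       (auto split: split_indicator simp: power_mult_distrib, simp add: power2_eq_square mult_ac)
  finally show ?thesis unfolding * .
qed

text \<open>With \<open>E\<close> the mean over a Gaussian vector in dimension \<open>n\<close>, the claim is \<open>E|u| E(1/|u|) \<le> 2\<close>.
  The recursion gives \<open>E(1/|u|) = 2/(n - 1) E|u|\<close> and \<open>E|u|\<^sup>2 = n/2\<close>, so the left-hand side is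
  \<open>2/(n - 1) (E|u|)\<^sup>2 \<le> n/(n - 1)\<close>.\<close>

lemma gauss_moment_bound:
  assumes "n \<ge> 2"
  shows "gauss_moment n * gauss_moment (n - 2) \<le> 2 * (gauss_moment (n - 1))\<^sup>2"
proof -
  obtain m where n: "n = Suc (Suc m)" using assms by (metis add_2_eq_Suc le_Suc_ex)
  let ?J = "\<lambda>k. enn2real (gauss_moment k)"
  have J: "gauss_moment k = ennreal (?J k)" for k
    using gauss_moment_finite[of k] by simp
  have Jn: "?J k \<ge> 0" for k by simp
  have step: "?J (Suc (Suc k)) = (k + 1) / 2 * ?J k" for k
    by (simp add: gauss_moment_Suc_Suc enn2real_mult)
  \<comment> \<open>\<open>(E|u|)\<^sup>2 \<le> E|u|\<^sup>2\<close>, multiplied by the square of the total mass\<close>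
  have "?J (Suc (Suc m)) ^ 2 \<le> ?J (Suc m) * ?J (Suc (Suc (Suc m)))"
    using gauss_moment_log_convex[of "Suc m"]
    by (subst (asm) (1 2 3) J) (simp add: ennreal_power ennreal_mult'[symmetric] del: ennreal_enn2real)
  also have "\<dots> = (m + 2) / 2 * (?J (Suc m))\<^sup>2"
    unfolding step[of "Suc m"] by (simp add: power2_eq_square)
  finally have 1: "?J (Suc (Suc m)) ^ 2 \<le> (m + 2) / 2 * (?J (Suc m))\<^sup>2" .
  have "?J (Suc (Suc m)) * ?J m = 2 / (m + 1) * ?J (Suc (Suc m)) ^ 2"
    unfolding step[of m] by (simp add: power2_eq_square field_simps)
  also have "\<dots> \<le> 2 / (m + 1) * ((m + 2) / 2 * (?J (Suc m))\<^sup>2)"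
    by (rule mult_left_mono[OF 1]) simp
  also have "\<dots> = (m + 2) / (m + 1) * (?J (Suc m))\<^sup>2" by (simp add: field_simps)
  also have "\<dots> \<le> 2 * (?J (Suc m))\<^sup>2"
    by (rule mult_right_mono) (auto simp: field_simps)
  finally have "ennreal (?J (Suc (Suc m)) * ?J m) \<le> ennreal (2 * (?J (Suc m))\<^sup>2)"
    by (rule ennreal_leI)
  then show ?thesis unfolding n
    by (subst (1 2 3) J) (simp add: ennreal_power ennreal_mult' del: ennreal_enn2real)
qed

section \<open>The Gaussian measure and uniform directions\<close>

definition gauss_mass :: "'a::euclidean_space itself \<Rightarrow> ennreal" where
  "gauss_mass _ = (\<integral>\<^sup>+x. ennreal (exp (- (norm (x::'a))\<^sup>2)) \<partial>lborel)"

definition gauss :: "'a::euclidean_space measure" where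
  "gauss = density lborel (\<lambda>x. ennreal (exp (- (norm x)\<^sup>2)) / gauss_mass TYPE('a))"

lemma sets_gauss [measurable_cong, simp]: "sets gauss = sets borel"
  by (simp add: gauss_def)

lemma space_gauss [simp]: "space gauss = UNIV"
  by (simp add: gauss_def)

lemma ball_measure_pos_finite:
  "0 < emeasure lborel (ball (0::'a::euclidean_space) 1)"
  "emeasure lborel (ball (0::'a::euclidean_space) 1) < \<infinity>"
  by (simp_all add: emeasure_ball)

lemma gauss_mass_eq:
  "gauss_mass TYPE('a::euclidean_space)
    = ennreal DIM('a) * gauss_moment (DIM('a) - 1) * emeasure lborel (ball (0::'a) 1)"
proof -
  have "gauss_mass TYPE('a) = (\<integral>\<^sup>+x. ennreal (exp (- (norm (x::'a))\<^sup>2)) * 1 \<partial>lborel)"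
    by (simp add: gauss_mass_def)
  also have "\<dots> = ennreal DIM('a) * (\<integral>\<^sup>+\<rho>. ennreal (\<rho> ^ (DIM('a) - 1)) * indicator {0<..} \<rho> * ennreal (exp (- \<rho>\<^sup>2)) \<partial>lborel)
      * (\<integral>\<^sup>+z. 1 * indicator (ball 0 1) (z::'a) \<partial>lborel)"
    by (rule nn_integral_radial) measurable
  also have "(\<integral>\<^sup>+\<rho>. ennreal (\<rho> ^ (DIM('a) - 1)) * indicator {0<..} \<rho> * ennreal (exp (- \<rho>\<^sup>2)) \<partial>lborel) = gauss_moment (DIM('a) - 1)"
    unfolding gauss_moment_def
    by (intro nn_integral_cong) (auto split: split_indicator simp: ennreal_mult')
  finally show ?thesis by simp
qed

lemma gauss_mass_pos: "0 < gauss_mass TYPE('a::euclidean_space)"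
  and gauss_mass_finite: "gauss_mass TYPE('a::euclidean_space) < \<infinity>"
  unfolding gauss_mass_eq
  using gauss_moment_pos[of "DIM('a) - 1"] gauss_moment_finite[of "DIM('a) - 1"]
     ball_measure_pos_finite[where 'a='a]
  by (auto simp: ennreal_zero_less_mult_iff ennreal_mult_less_top)

lemma nn_integral_gauss:
  assumes [measurable]: "F \<in> borel_measurable borel"
  shows "(\<integral>\<^sup>+x. F x \<partial>(gauss::'a::euclidean_space measure))
    = (\<integral>\<^sup>+x. ennreal (exp (- (norm x)\<^sup>2)) * F x \<partial>lborel) / gauss_mass TYPE('a)"
  unfolding gauss_def
  by (subst nn_integral_density)
     (auto simp: divide_ennreal_def nn_integral_multc[symmetric] mult_ac simp del: nn_integral_cmult
       simp flip: nn_integral_cmult)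

lemma prob_space_gauss: "prob_space (gauss::'a::euclidean_space measure)"
proof
  have "emeasure (gauss::'a measure) (space gauss) = (\<integral>\<^sup>+x. 1 \<partial>(gauss::'a measure))" by simp
  also have "\<dots> = gauss_mass TYPE('a) / gauss_mass TYPE('a)"
    by (subst nn_integral_gauss) (simp_all add: gauss_mass_def)
  also have "\<dots> = 1"
    using gauss_mass_pos[where 'a='a] gauss_mass_finite[where 'a='a] by (simp add: ennreal_divide_self)
  finally show "emeasure (gauss::'a measure) (space gauss) = 1" .
qed

lemma AE_gauss: "AE x in lborel. P x \<Longrightarrow> AE x in gauss. P x"
  unfolding gauss_def by (subst AE_density) auto

text \<open>Under the Gaussian measure, \<open>|x|\<close> and \<open>sgn x\<close> are independent and \<open>|x|\<close> has a density
  proportional to \<open>\<rho>\<^sup>n\<^sup>-\<^sup>1 exp(- \<rho>\<^sup>2)\<close>; the normalizing moment stands on the left to avoid a division.\<close>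

lemma nn_integral_gauss_radial:
  fixes q :: "'a::euclidean_space \<Rightarrow> ennreal"
  assumes [measurable]: "k \<in> borel_measurable borel" "q \<in> borel_measurable borel"
  shows "(\<integral>\<^sup>+x. k (norm x) * q (sgn x) \<partial>gauss) * gauss_moment (DIM('a) - 1) =
    (\<integral>\<^sup>+\<rho>. ennreal (\<rho> ^ (DIM('a) - 1) * exp (- \<rho>\<^sup>2)) * indicator {0<..} \<rho> * k \<rho> \<partial>lborel)
      * (\<integral>\<^sup>+x. q (sgn x) \<partial>gauss)"
proof -
  let ?Z = "gauss_mass TYPE('a)"
  let ?\<beta> = "\<integral>\<^sup>+z. q (sgn z) * indicator (ball 0 1) z \<partial>lborel"
  let ?J = "\<lambda>k. \<integral>\<^sup>+\<rho>. ennreal (\<rho> ^ (DIM('a) - 1) * exp (- \<rho>\<^sup>2)) * indicator {0<..} \<rho> * k \<rho> \<partial>lborel"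
  have *: "(\<integral>\<^sup>+x. k (norm x) * q (sgn x) \<partial>gauss) = ennreal DIM('a) * ?J k * ?\<beta> / ?Z"
    if [measurable]: "k \<in> borel_measurable borel" for k
  proof -
    have "(\<integral>\<^sup>+x. k (norm x) * q (sgn x) \<partial>gauss)
        = (\<integral>\<^sup>+x. (ennreal (exp (- (norm x)\<^sup>2)) * k (norm x)) * q (sgn x) \<partial>lborel) / ?Z"
      by (subst nn_integral_gauss) (auto simp: mult_ac)
    also have "(\<integral>\<^sup>+x. (ennreal (exp (- (norm x)\<^sup>2)) * k (norm x)) * q (sgn x) \<partial>lborel)
        = ennreal DIM('a) * (\<integral>\<^sup>+\<rho>. ennreal (\<rho> ^ (DIM('a) - 1)) * indicator {0<..} \<rho> * (ennreal (exp (- \<rho>\<^sup>2)) * k \<rho>) \<partial>lborel) * ?\<beta>"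
      by (rule nn_integral_radial) measurable
    also have "(\<integral>\<^sup>+\<rho>. ennreal (\<rho> ^ (DIM('a) - 1)) * indicator {0<..} \<rho> * (ennreal (exp (- \<rho>\<^sup>2)) * k \<rho>) \<partial>lborel) = ?J k"
      by (intro nn_integral_cong) (auto simp: ennreal_mult' mult_ac split: split_indicator)
    finally show ?thesis .
  qed
  have "?J (\<lambda>_. 1) = gauss_moment (DIM('a) - 1)" by (simp add: gauss_moment_def)
  moreover have "(\<integral>\<^sup>+x. q (sgn x) \<partial>gauss) = ennreal DIM('a) * ?J (\<lambda>_. 1) * ?\<beta> / ?Z"
    using *[of "\<lambda>_. 1"] by simp
  ultimately show ?thesis
    by (simp only: *[OF assms(1)]) (simp add: divide_ennreal_def mult_ac)
qed

text \<open>A Gaussian vector and a uniform point of the unit ball have the same distribution of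
  directions.\<close>

lemma nn_integral_gauss_sgn:
  fixes q :: "'a::euclidean_space \<Rightarrow> ennreal"
  assumes [measurable]: "q \<in> borel_measurable borel"
  shows "emeasure lborel (ball (0::'a) 1) * (\<integral>\<^sup>+x. q (sgn x) \<partial>gauss) = (\<integral>\<^sup>+z. q (sgn z) * indicator (ball 0 1) z \<partial>lborel)"
proof -
  let ?\<beta> = "\<integral>\<^sup>+z. q (sgn z) * indicator (ball 0 1) z \<partial>lborel"
  let ?b = "emeasure lborel (ball (0::'a) 1)"
  let ?m = "ennreal DIM('a) * gauss_moment (DIM('a) - 1)"
  have "(\<integral>\<^sup>+x. q (sgn x) \<partial>gauss) = (\<integral>\<^sup>+x. ennreal (exp (- (norm x)\<^sup>2)) * q (sgn x) \<partial>lborel) / gauss_mass TYPE('a)"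
    by (rule nn_integral_gauss) measurable
  also have "(\<integral>\<^sup>+x. ennreal (exp (- (norm x)\<^sup>2)) * q (sgn x) \<partial>lborel)
    = ennreal DIM('a) * (\<integral>\<^sup>+\<rho>. ennreal (\<rho> ^ (DIM('a) - 1)) * indicator {0<..} \<rho> * ennreal (exp (- \<rho>\<^sup>2)) \<partial>lborel) * ?\<beta>"
    by (rule nn_integral_radial) measurable
  also have "(\<integral>\<^sup>+\<rho>. ennreal (\<rho> ^ (DIM('a) - 1)) * indicator {0<..} \<rho> * ennreal (exp (- \<rho>\<^sup>2)) \<partial>lborel) = gauss_moment (DIM('a) - 1)"
    unfolding gauss_moment_def
    by (intro nn_integral_cong) (auto split: split_indicator simp: ennreal_mult')
  finally have "?b * (\<integral>\<^sup>+x. q (sgn x) \<partial>gauss) = ?\<beta> * (gauss_mass TYPE('a) / gauss_mass TYPE('a))"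
    by (simp add: gauss_mass_eq[where 'a='a] divide_ennreal_def mult_ac)
  then show ?thesis
    using gauss_mass_pos[where 'a='a] gauss_mass_finite[where 'a='a] by (simp add: ennreal_divide_self)
qed

lemma unit_sphere_area_eq:
  assumes "n > 0"
  shows "unit_sphere_area n = n * unit_ball_vol n"
proof -
  have "real n / 2 > 0" using assms by simp
  then have G: "Gamma (real n / 2) > 0" "Gamma (real n / 2 + 1) = real n / 2 * Gamma (real n / 2)"
    using Gamma_plus1[of "real n / 2"] nonpos_Ints_nonpos[of "real n / 2"] by (auto simp: Gamma_real_pos)
  show ?thesis
    unfolding unit_sphere_area_def unit_ball_vol_def G(2) using assms G(1) by simp
qed

lemma nn_integral_polar_gauss:
  fixes F :: "'a::euclidean_space \<Rightarrow> ennreal"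
  assumes [measurable]: "F \<in> borel_measurable borel"
  shows "(\<integral>\<^sup>+x. F x \<partial>lborel) =
    (\<integral>\<^sup>+\<rho>. ennreal (unit_sphere_area DIM('a) * \<rho> ^ (DIM('a) - 1)) * indicator {0<..} \<rho> *
        (\<integral>\<^sup>+z. F (\<rho> *\<^sub>R sgn z) \<partial>gauss) \<partial>lborel)"
proof -
  have "ennreal (DIM('a) * \<rho> ^ (DIM('a) - 1)) * indicator {0<..} \<rho> *
        (\<integral>\<^sup>+z. F (\<rho> *\<^sub>R sgn z) * indicator (ball 0 1) z \<partial>lborel)
      = ennreal (unit_sphere_area DIM('a) * \<rho> ^ (DIM('a) - 1)) * indicator {0<..} \<rho> *
        (\<integral>\<^sup>+z. F (\<rho> *\<^sub>R sgn z) \<partial>gauss)" for \<rho> :: real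
  proof -
    have "(\<integral>\<^sup>+z. F (\<rho> *\<^sub>R sgn z) * indicator (ball 0 1) z \<partial>lborel)
        = ennreal (unit_ball_vol DIM('a)) * (\<integral>\<^sup>+z. F (\<rho> *\<^sub>R sgn z) \<partial>gauss)"
      using nn_integral_gauss_sgn[of "\<lambda>z. F (\<rho> *\<^sub>R z)"] by (simp add: emeasure_ball)
    then show ?thesis
      by (cases "\<rho> > 0") (simp_all add: unit_sphere_area_eq ennreal_mult' mult_ac)
  qed
  then show ?thesis by (subst nn_integral_polar) simp_all
qed

section \<open>Rotations of a pair of Gaussian vectors\<close>

lemma nn_integral_lborel_shear:
  fixes G :: "'a::euclidean_space \<Rightarrow> 'a \<Rightarrow> ennreal"
  assumes [measurable]: "case_prod G \<in> borel_measurable (borel \<Otimes>\<^sub>M borel)"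
  shows "(\<integral>\<^sup>+x. \<integral>\<^sup>+y. G x (y + b *\<^sub>R x) \<partial>lborel \<partial>lborel) = (\<integral>\<^sup>+x. \<integral>\<^sup>+y. G x y \<partial>lborel \<partial>lborel)"
    and "(\<integral>\<^sup>+x. \<integral>\<^sup>+y. G (x + b *\<^sub>R y) y \<partial>lborel \<partial>lborel) = (\<integral>\<^sup>+x. \<integral>\<^sup>+y. G x y \<partial>lborel \<partial>lborel)"
proof -
  have *: "(\<integral>\<^sup>+y. G x (y + b *\<^sub>R x) \<partial>lborel) = (\<integral>\<^sup>+y. G x y \<partial>lborel)" for x
    using nn_integral_lborel_translate[of "G x" "b *\<^sub>R x"] by (simp add: add.commute)
  have **: "(\<integral>\<^sup>+x. G (x + b *\<^sub>R y) y \<partial>lborel) = (\<integral>\<^sup>+x. G x y \<partial>lborel)" for y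
    using nn_integral_lborel_translate[of "\<lambda>x. G x y" "b *\<^sub>R y"] by (simp add: add.commute)
  show "(\<integral>\<^sup>+x. \<integral>\<^sup>+y. G x (y + b *\<^sub>R x) \<partial>lborel \<partial>lborel) = (\<integral>\<^sup>+x. \<integral>\<^sup>+y. G x y \<partial>lborel \<partial>lborel)"
    by (simp add: *)
  have "(\<integral>\<^sup>+x. \<integral>\<^sup>+y. G (x + b *\<^sub>R y) y \<partial>lborel \<partial>lborel) = (\<integral>\<^sup>+y. \<integral>\<^sup>+x. G (x + b *\<^sub>R y) y \<partial>lborel \<partial>lborel)"
    by (rule lborel_pair.Fubini') simp
  also have "\<dots> = (\<integral>\<^sup>+y. \<integral>\<^sup>+x. G x y \<partial>lborel \<partial>lborel)" by (simp add: **)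
  also have "\<dots> = (\<integral>\<^sup>+x. \<integral>\<^sup>+y. G x y \<partial>lborel \<partial>lborel)"
    by (rule lborel_pair.Fubini') (simp add: case_prod_beta)
  finally show "(\<integral>\<^sup>+x. \<integral>\<^sup>+y. G (x + b *\<^sub>R y) y \<partial>lborel \<partial>lborel) = (\<integral>\<^sup>+x. \<integral>\<^sup>+y. G x y \<partial>lborel \<partial>lborel)" .
qed

text \<open>The rotation \<open>(x, y) \<mapsto> (c x + s y, c y - s x)\<close> is the composition of three shears
  \<open>x \<mapsto> x + p y\<close>, \<open>y \<mapsto> y - s x\<close>, \<open>x \<mapsto> x + p y\<close> with \<open>p = s/(1 + c)\<close>, and a shear is a translation
  in one of the two integrations.\<close>

lemma nn_integral_lborel_rotation:
  fixes G :: "'a::euclidean_space \<Rightarrow> 'a \<Rightarrow> ennreal"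
  assumes G[measurable]: "case_prod G \<in> borel_measurable (borel \<Otimes>\<^sub>M borel)"
    and cs: "c\<^sup>2 + s\<^sup>2 = 1" and c: "c > 0"
  shows "(\<integral>\<^sup>+x. \<integral>\<^sup>+y. G (c *\<^sub>R x + s *\<^sub>R y) (c *\<^sub>R y - s *\<^sub>R x) \<partial>lborel \<partial>lborel)
    = (\<integral>\<^sup>+x. \<integral>\<^sup>+y. G x y \<partial>lborel \<partial>lborel)"
proof -
  define p where "p = s / (1 + c)"
  have "(1 + c) * (1 - c) = s * s" using cs by (simp add: algebra_simps power2_eq_square)
  then have p1: "1 - s * p = c" using c by (simp add: p_def field_simps)
  have p2: "p * (1 + c) = s" using c by (simp add: p_def)
  define A where "A = (\<lambda>x y. G (x + p *\<^sub>R y) y)"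
  define B where "B = (\<lambda>x y. A x (y + (- s) *\<^sub>R x))"
  have [measurable]: "case_prod A \<in> borel_measurable (borel \<Otimes>\<^sub>M borel)" unfolding A_def by simp
  have [measurable]: "case_prod B \<in> borel_measurable (borel \<Otimes>\<^sub>M borel)" unfolding B_def by simp
  have y: "y + (- s) *\<^sub>R (x + p *\<^sub>R y) = c *\<^sub>R y - s *\<^sub>R x" for x y :: 'a
  proof -
    have "y + (- s) *\<^sub>R (x + p *\<^sub>R y) = (1 - s * p) *\<^sub>R y - s *\<^sub>R x" by (simp add: algebra_simps)
    then show ?thesis by (simp add: p1)
  qed
  have x: "x + p *\<^sub>R y + p *\<^sub>R (c *\<^sub>R y - s *\<^sub>R x) = c *\<^sub>R x + s *\<^sub>R y" for x y :: 'a
  proof -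
    have "x + p *\<^sub>R y + p *\<^sub>R (c *\<^sub>R y - s *\<^sub>R x) = (1 - s * p) *\<^sub>R x + (p * (1 + c)) *\<^sub>R y" by (simp add: algebra_simps)
    then show ?thesis by (simp only: p1 p2)
  qed
  have "B (x + p *\<^sub>R y) y = G (c *\<^sub>R x + s *\<^sub>R y) (c *\<^sub>R y - s *\<^sub>R x)" for x y
    unfolding B_def A_def y x ..
  then have "(\<integral>\<^sup>+x. \<integral>\<^sup>+y. G (c *\<^sub>R x + s *\<^sub>R y) (c *\<^sub>R y - s *\<^sub>R x) \<partial>lborel \<partial>lborel)
     = (\<integral>\<^sup>+x. \<integral>\<^sup>+y. B (x + p *\<^sub>R y) y \<partial>lborel \<partial>lborel)" by simp
  also have "\<dots> = (\<integral>\<^sup>+x. \<integral>\<^sup>+y. B x y \<partial>lborel \<partial>lborel)" by (rule nn_integral_lborel_shear) simp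
  also have "\<dots> = (\<integral>\<^sup>+x. \<integral>\<^sup>+y. A x y \<partial>lborel \<partial>lborel)" unfolding B_def by (rule nn_integral_lborel_shear) simp
  also have "\<dots> = (\<integral>\<^sup>+x. \<integral>\<^sup>+y. G x y \<partial>lborel \<partial>lborel)" unfolding A_def by (rule nn_integral_lborel_shear) simp
  finally show ?thesis .
qed

text \<open>The joint density depends on \<open>|x|\<^sup>2 + |y|\<^sup>2\<close> only, which the rotation preserves.\<close>

lemma nn_integral_gauss_rotation:
  fixes G :: "'a::euclidean_space \<Rightarrow> 'a \<Rightarrow> ennreal"
  assumes G[measurable]: "case_prod G \<in> borel_measurable (borel \<Otimes>\<^sub>M borel)"
    and cs: "c\<^sup>2 + s\<^sup>2 = 1" and c: "c > 0"
  shows "(\<integral>\<^sup>+x. \<integral>\<^sup>+y. G (c *\<^sub>R x + s *\<^sub>R y) (c *\<^sub>R y - s *\<^sub>R x) \<partial>gauss \<partial>gauss)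
    = (\<integral>\<^sup>+x. \<integral>\<^sup>+y. G x y \<partial>gauss \<partial>gauss)"
proof -
  let ?Z = "gauss_mass TYPE('a)"
  have *: "(\<integral>\<^sup>+x. \<integral>\<^sup>+y. H x y \<partial>gauss \<partial>gauss)
      = (\<integral>\<^sup>+x. \<integral>\<^sup>+y. ennreal (exp (- ((norm x)\<^sup>2 + (norm y)\<^sup>2))) * H x y / (?Z * ?Z) \<partial>lborel \<partial>lborel)"
    if [measurable]: "case_prod H \<in> borel_measurable (borel \<Otimes>\<^sub>M borel)" for H :: "'a \<Rightarrow> 'a \<Rightarrow> ennreal"
  proof -
    have Z: "inverse (?Z * ?Z) = inverse ?Z * inverse ?Z"
      using gauss_mass_pos[where 'a='a] gauss_mass_finite[where 'a='a]
      by (intro ennreal_inverse_mult) auto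
    have e: "ennreal (exp (- (norm x)\<^sup>2 - (norm y)\<^sup>2))
        = ennreal (exp (- (norm x)\<^sup>2)) * ennreal (exp (- (norm y)\<^sup>2))" for x y :: 'a
      by (simp add: ennreal_mult'[symmetric] exp_add[symmetric])
    have 1: "(\<lambda>x. \<integral>\<^sup>+y. H x y \<partial>gauss) \<in> borel_measurable borel"
      using prob_space_gauss[where 'a='a]
      by (intro sigma_finite_measure.borel_measurable_nn_integral) (auto simp: prob_space_imp_sigma_finite)
    show ?thesis
      apply (subst nn_integral_gauss[OF 1])
      apply (subst nn_integral_gauss)
       apply measurable
      apply (simp add: divide_ennreal_def Z nn_integral_multc[symmetric] nn_integral_cmult[symmetric])
      apply (intro nn_integral_cong)
      apply (simp add: e mult_ac)
      done
  qed
  have inv: "(norm (c *\<^sub>R x + s *\<^sub>R y))\<^sup>2 + (norm (c *\<^sub>R y - s *\<^sub>R x))\<^sup>2 = (norm x)\<^sup>2 + (norm y)\<^sup>2" for x y :: 'a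
  proof -
    have "(norm (c *\<^sub>R x + s *\<^sub>R y))\<^sup>2 + (norm (c *\<^sub>R y - s *\<^sub>R x))\<^sup>2 = (c\<^sup>2 + s\<^sup>2) * ((norm x)\<^sup>2 + (norm y)\<^sup>2)"
      by (simp add: power2_norm_eq_inner inner_add inner_diff inner_commute algebra_simps power2_eq_square[of c] power2_eq_square[of s])
    then show ?thesis by (simp add: cs)
  qed
  show ?thesis
    apply (subst (1 2) *)
      apply measurable
    using nn_integral_lborel_rotation[OF _ cs c,
        of "\<lambda>x y. ennreal (exp (- ((norm x)\<^sup>2 + (norm y)\<^sup>2))) * G x y / (?Z * ?Z)"]
    by (simp only: inv) simp
qed

section \<open>Energy of an arc on the sphere\<close>

text \<open>The Gram determinant of two vectors, that is, the squared area of the parallelogram that they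
  span.\<close>

definition gram :: "'a::real_inner \<Rightarrow> 'a \<Rightarrow> real" where
  "gram x y = (norm x)\<^sup>2 * (norm y)\<^sup>2 - (x \<bullet> y)\<^sup>2"

text \<open>On the unit sphere this is the squared length of the tangential component of the vector field
  \<open>g\<close>.\<close>

definition tan_energy :: "('a::real_inner \<Rightarrow> 'a) \<Rightarrow> 'a \<Rightarrow> real" where
  "tan_energy g \<theta> = (norm (g \<theta>))\<^sup>2 - (\<theta> \<bullet> g \<theta>)\<^sup>2"

lemma gram_nonneg: "0 \<le> gram x y"
  unfolding gram_def using Cauchy_Schwarz_ineq[of x y] by (simp add: power2_norm_eq_inner)

lemma gram_rotation:
  assumes "c\<^sup>2 + s\<^sup>2 = (1::real)"
  shows "gram (c *\<^sub>R x + s *\<^sub>R y) (c *\<^sub>R y - s *\<^sub>R x) = gram x y"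
proof -
  have "gram (c *\<^sub>R x + s *\<^sub>R y) (c *\<^sub>R y - s *\<^sub>R x) = (c\<^sup>2 + s\<^sup>2)\<^sup>2 * gram x y"
    unfolding gram_def power2_norm_eq_inner
    by (simp add: inner_add inner_diff inner_commute[of y x]) algebra
  then show ?thesis by (simp add: assms)
qed

lemma tan_energy_nonneg: "norm \<theta> \<le> 1 \<Longrightarrow> 0 \<le> tan_energy g \<theta>"
proof -
  assume "norm \<theta> \<le> 1"
  have "\<bar>\<theta> \<bullet> g \<theta>\<bar> \<le> norm \<theta> * norm (g \<theta>)" by (rule Cauchy_Schwarz_ineq2)
  also have "\<dots> \<le> 1 * norm (g \<theta>)" using \<open>norm \<theta> \<le> 1\<close> by (intro mult_right_mono) auto
  finally have "(\<theta> \<bullet> g \<theta>)\<^sup>2 \<le> (norm (g \<theta>))\<^sup>2" by (simp add: abs_le_square_iff[symmetric])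
  then show ?thesis by (simp add: tan_energy_def)
qed

text \<open>A tangent vector does not see the component of \<open>g \<theta>\<close> in the direction of \<open>\<theta>\<close>.\<close>

lemma inner_tangent_le:
  assumes "norm \<theta> = 1" "\<tau> \<bullet> \<theta> = 0"
  shows "\<bar>\<tau> \<bullet> g \<theta>\<bar> \<le> norm \<tau> * sqrt (tan_energy g \<theta>)"
proof -
  let ?p = "g \<theta> - (\<theta> \<bullet> g \<theta>) *\<^sub>R \<theta>"
  have "\<theta> \<bullet> \<theta> = 1" using assms(1) by (simp add: power2_norm_eq_inner[symmetric])
  then have "(norm ?p)\<^sup>2 = tan_energy g \<theta>"
    unfolding tan_energy_def power2_norm_eq_inner
    by (simp add: inner_diff inner_commute power2_eq_square)
  then have "sqrt (tan_energy g \<theta>) = norm ?p" by (metis norm_ge_zero real_sqrt_unique)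
  moreover have "\<tau> \<bullet> g \<theta> = \<tau> \<bullet> ?p" using assms(2) by (simp add: inner_diff)
  ultimately show ?thesis using Cauchy_Schwarz_ineq2[of \<tau> ?p] by simp
qed

text \<open>The curve \<open>\<theta>(s) = sgn (cos s x + sin s y)\<close> runs along a great circle with speed
  \<open>\<kappa>(s) = \<surd>(gram x y) / |cos s x + sin s y|\<^sup>2\<close>, and its length on the parameter interval is at most \<open>\<pi>\<close>.
  The claim is the Cauchy-Schwarz inequality for the increment of \<open>\<psi>\<close> along it, with respect to arc
  length. The parameter interval is symmetric about \<open>0\<close> and shorter than \<open>\<pi>\<close> so that \<open>tan\<close> is smooth on
  it and \<open>\<kappa>\<close> has an arctangent as antiderivative.\<close>

lemma square_increment_le_energy_of_arc:
  fixes x y :: "'a::euclidean_space" and \<psi> :: "'a \<Rightarrow> real" and g :: "'a \<Rightarrow> 'a"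
  assumes der: "\<And>z. (\<psi> has_derivative (\<lambda>h. h \<bullet> g z)) (at z)"
    and cont: "continuous_on UNIV g"
    and pos: "gram x y > 0"
  shows "ennreal ((\<psi> (sgn (cos (pi/4) *\<^sub>R x + sin (pi/4) *\<^sub>R y)) - \<psi> (sgn (cos (pi/4) *\<^sub>R x - sin (pi/4) *\<^sub>R y)))\<^sup>2)
    \<le> ennreal pi * (\<integral>\<^sup>+s\<in>{-(pi/4)..pi/4}. ennreal (tan_energy g (sgn (cos s *\<^sub>R x + sin s *\<^sub>R y)) *
          (sqrt (gram x y) / (norm (cos s *\<^sub>R x + sin s *\<^sub>R y))\<^sup>2)) \<partial>lborel)"
proof -
  define D where "D = gram x y"
  define \<gamma> where "\<gamma> s = cos s *\<^sub>R x + sin s *\<^sub>R y" for s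
  define \<gamma>' where "\<gamma>' s = cos s *\<^sub>R y - sin s *\<^sub>R x" for s
  define \<kappa> where "\<kappa> s = sqrt D / (norm (\<gamma> s))\<^sup>2" for s
  define \<theta> where "\<theta> s = sgn (\<gamma> s)" for s
  define \<tau> where "\<tau> s = (1 / norm (\<gamma> s)) *\<^sub>R \<gamma>' s - ((\<gamma> s \<bullet> \<gamma>' s) / norm (\<gamma> s) ^ 3) *\<^sub>R \<gamma> s" for s
  define \<Delta> where "\<Delta> = \<psi> (\<theta> (pi/4)) - \<psi> (\<theta> (-(pi/4)))"
  let ?I = "{-(pi/4)..pi/4}"
  \<comment> \<open>The Gram determinant is constant along the arc; this keeps \<open>\<gamma>\<close> away from \<open>0\<close> and gives the speed.\<close>
  have D: "gram (\<gamma> s) (\<gamma>' s) = D" for s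
    unfolding \<gamma>_def \<gamma>'_def D_def by (rule gram_rotation) simp
  have D0: "D > 0" using pos by (simp add: D_def)
  have nz: "\<gamma> s \<noteq> 0" for s
    using D[of s] D0 by (auto simp: gram_def)
  have \<gamma>_der: "(\<gamma> has_vector_derivative \<gamma>' s) (at s within S)" for s S
    unfolding \<gamma>_def[abs_def] \<gamma>'_def by (auto intro!: derivative_eq_intros)
  have n_der: "((\<lambda>s. norm (\<gamma> s)) has_real_derivative (\<gamma>' s \<bullet> sgn (\<gamma> s))) (at s within S)" for s S
  proof -
    have "((\<lambda>s. norm (\<gamma> s)) has_derivative (\<lambda>h. (h *\<^sub>R \<gamma>' s) \<bullet> sgn (\<gamma> s))) (at s within S)"
      using has_derivative_compose[OF \<gamma>_der[unfolded has_vector_derivative_def] has_derivative_norm[OF nz]] .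
    then show ?thesis by (simp add: has_field_derivative_def mult.commute[of _ "\<gamma>' s \<bullet> sgn (\<gamma> s)"])
  qed
  have \<theta>_der: "(\<theta> has_vector_derivative \<tau> s) (at s within S)" for s S
  proof -
    have "((\<lambda>s. inverse (norm (\<gamma> s)) *\<^sub>R \<gamma> s) has_vector_derivative
        (inverse (norm (\<gamma> s)) *\<^sub>R \<gamma>' s + (- (inverse (norm (\<gamma> s)) * (\<gamma>' s \<bullet> sgn (\<gamma> s)) * inverse (norm (\<gamma> s)))) *\<^sub>R \<gamma> s)) (at s within S)"
      by (intro has_vector_derivative_scaleR \<gamma>_der DERIV_inverse' n_der) (simp add: nz)
    then show ?thesis
      unfolding \<theta>_def[abs_def] \<tau>_def sgn_div_norm
      by (simp add: inverse_eq_divide inner_commute power3_eq_cube mult_ac)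
  qed
  have h_der: "((\<lambda>s. \<psi> (\<theta> s)) has_vector_derivative (\<tau> s \<bullet> g (\<theta> s))) (at s within S)" for s S
    using has_derivative_compose[OF \<theta>_der[unfolded has_vector_derivative_def] der]
    by (simp add: has_vector_derivative_def)
  have nth: "norm (\<theta> s) = 1" for s by (simp add: \<theta>_def norm_sgn nz)
  have orth: "\<tau> s \<bullet> \<theta> s = 0" for s
    using nz[of s] unfolding \<tau>_def \<theta>_def sgn_div_norm
    by (simp add: inner_diff inner_commute power2_norm_eq_inner[symmetric] power2_eq_square power3_eq_cube field_simps)
  have ntau: "norm (\<tau> s) = \<kappa> s" for s
  proof -
    define r where "r = norm (\<gamma> s)"
    have r: "r > 0" "\<gamma> s \<bullet> \<gamma> s = r\<^sup>2" using nz[of s] by (simp_all add: r_def power2_norm_eq_inner)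
    have "(norm (\<tau> s))\<^sup>2 = (norm (\<gamma>' s))\<^sup>2 / r\<^sup>2 - 2 * (\<gamma> s \<bullet> \<gamma>' s)\<^sup>2 / r ^ 4 + (\<gamma> s \<bullet> \<gamma>' s)\<^sup>2 / r ^ 6 * r\<^sup>2"
      unfolding \<tau>_def r_def[symmetric] power2_norm_eq_inner
      by (simp add: inner_diff inner_commute r(2) power2_eq_square power3_eq_cube power4_eq_xxxx eval_nat_numeral)
    also have "\<dots> = D / r ^ 4"
      using r(1) unfolding D[of s, symmetric] gram_def r_def[symmetric]
      by (simp add: field_simps eval_nat_numeral)
    also have "\<dots> = (\<kappa> s)\<^sup>2"
      using D0 by (simp add: \<kappa>_def r_def[symmetric] power_divide)
    finally show ?thesis
      using D0 by (simp add: \<kappa>_def power2_eq_iff_nonneg)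
  qed
  have \<kappa>_pos: "\<kappa> s > 0" for s using nz[of s] D0 by (simp add: \<kappa>_def)
  have cont\<gamma>: "continuous_on S \<gamma>" for S unfolding \<gamma>_def by (intro continuous_intros)
  have cont\<theta>: "continuous_on S \<theta>" for S
    unfolding \<theta>_def by (intro continuous_on_sgn cont\<gamma>) (simp add: nz)
  have contE: "continuous_on S (\<lambda>s. tan_energy g (\<theta> s) * \<kappa> s)" for S
    unfolding tan_energy_def \<kappa>_def
    by (intro continuous_intros cont\<gamma> cont\<theta> continuous_on_compose2[OF cont cont\<theta>]) (auto simp: nz)
  have E_nonneg: "0 \<le> tan_energy g (\<theta> s)" for s by (rule tan_energy_nonneg) (simp add: nth)
  define E where "E = integral ?I (\<lambda>s. tan_energy g (\<theta> s) * \<kappa> s)"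
  have hasE: "((\<lambda>s. tan_energy g (\<theta> s) * \<kappa> s) has_integral E) ?I"
    unfolding E_def by (intro integrable_integral integrable_continuous_interval contE)
  \<comment> \<open>Antiderivative of the speed: divide \<open>|\<gamma> s|\<^sup>2\<close> by \<open>(cos s)\<^sup>2\<close> to get a quadratic polynomial in \<open>tan s\<close>.\<close>
  define A where "A s = arctan (((norm y)\<^sup>2 * tan s + x \<bullet> y) / sqrt D)" for s
  have "(\<kappa> has_integral (A (pi/4) - A (-(pi/4)))) ?I"
  proof (rule fundamental_theorem_of_calculus)
    fix s assume s: "s \<in> ?I"
    have c: "cos s > 0" using s pi_gt_zero by (intro cos_gt_zero_pi; simp; linarith)
    have y: "norm y > 0" using pos by (auto simp: gram_def)
    define t where "t = tan s"
    have sq: "sqrt D ^ 2 = D" "sqrt D > 0" using D0 by simp_all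
    have "((\<lambda>s. ((norm y)\<^sup>2 * tan s + x \<bullet> y) / sqrt D) has_real_derivative ((norm y)\<^sup>2 * inverse ((cos s)\<^sup>2)) / sqrt D) (at s)"
      using c by (intro DERIV_cdivide) (auto intro!: derivative_eq_intros)
    then have "(A has_real_derivative inverse (1 + (((norm y)\<^sup>2 * tan s + x \<bullet> y) / sqrt D)\<^sup>2) * (((norm y)\<^sup>2 * inverse ((cos s)\<^sup>2)) / sqrt D)) (at s)"
      unfolding A_def[abs_def] by (rule DERIV_chain2[OF DERIV_arctan])
    moreover have "inverse (1 + (((norm y)\<^sup>2 * tan s + x \<bullet> y) / sqrt D)\<^sup>2) * (((norm y)\<^sup>2 * inverse ((cos s)\<^sup>2)) / sqrt D) = \<kappa> s"
    proof -
      have "(norm (\<gamma> s))\<^sup>2 = (cos s)\<^sup>2 * ((norm x)\<^sup>2 + 2 * (x \<bullet> y) * t + (norm y)\<^sup>2 * t\<^sup>2)"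
        using c unfolding \<gamma>_def t_def tan_def power2_norm_eq_inner
        by (simp add: inner_add inner_commute power2_eq_square field_simps)
      then have g2: "(norm y)\<^sup>2 * (norm (\<gamma> s))\<^sup>2 = (cos s)\<^sup>2 * (D + ((norm y)\<^sup>2 * t + x \<bullet> y)\<^sup>2)"
        unfolding D_def gram_def by (simp add: power2_eq_square algebra_simps)
      have p: "D + ((norm y)\<^sup>2 * t + x \<bullet> y)\<^sup>2 > 0" using D0 by (simp add: add_pos_nonneg)
      have "1 + (((norm y)\<^sup>2 * t + x \<bullet> y) / sqrt D)\<^sup>2 = (D + ((norm y)\<^sup>2 * t + x \<bullet> y)\<^sup>2) / D"
        using D0 by (simp add: power_divide field_simps)
      then have "inverse (1 + (((norm y)\<^sup>2 * t + x \<bullet> y) / sqrt D)\<^sup>2) * (((norm y)\<^sup>2 * inverse ((cos s)\<^sup>2)) / sqrt D)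
          = (D / sqrt D) * ((norm y)\<^sup>2 / ((cos s)\<^sup>2 * (D + ((norm y)\<^sup>2 * t + x \<bullet> y)\<^sup>2)))"
        by (simp add: field_simps)
      also have "\<dots> = sqrt D * ((norm y)\<^sup>2 / ((norm y)\<^sup>2 * (norm (\<gamma> s))\<^sup>2))"
        using D0 by (simp only: g2 real_div_sqrt less_imp_le)
      also have "\<dots> = \<kappa> s" using y by (simp add: \<kappa>_def)
      finally show ?thesis by (simp add: t_def)
    qed
    ultimately show "(A has_vector_derivative \<kappa> s) (at s within ?I)"
      by (simp add: has_real_derivative_iff_has_vector_derivative has_vector_derivative_at_within)
  qed simp
  moreover have "A (pi/4) - A (-(pi/4)) \<le> pi"
    unfolding A_def using arctan_ubound arctan_lbound by (smt (verit) field_sum_of_halves)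
  ultimately obtain K where K: "(\<kappa> has_integral K) ?I" "K \<le> pi" by blast
  have "((\<lambda>s. \<tau> s \<bullet> g (\<theta> s)) has_integral \<Delta>) ?I"
    unfolding \<Delta>_def by (intro fundamental_theorem_of_calculus h_der) simp
  then have L: "((\<lambda>s. \<Delta> * (\<tau> s \<bullet> g (\<theta> s))) has_integral \<Delta> * \<Delta>) ?I"
    by (rule has_integral_mult_right)
  have R: "((\<lambda>s. pi / 2 * (tan_energy g (\<theta> s) * \<kappa> s) + \<Delta>\<^sup>2 / (2 * pi) * \<kappa> s) has_integral
      (pi / 2 * E + \<Delta>\<^sup>2 / (2 * pi) * K)) ?I"
    by (intro has_integral_add has_integral_mult_right hasE K)
  \<comment> \<open>Cauchy-Schwarz without square roots of integrals: \<open>|\<Delta>| q \<le> (\<pi>/2) q\<^sup>2 + \<Delta>\<^sup>2/(2\<pi>)\<close> is weighted so that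
      after integration the last term is at most \<open>\<Delta>\<^sup>2/2\<close> and is absorbed on the left.\<close>
  have "\<Delta> * \<Delta> \<le> pi / 2 * E + \<Delta>\<^sup>2 / (2 * pi) * K"
  proof (rule has_integral_le[OF L R])
    fix s
    define q where "q = sqrt (tan_energy g (\<theta> s))"
    have q: "q\<^sup>2 = tan_energy g (\<theta> s)" using E_nonneg by (simp add: q_def)
    have "\<Delta> * (\<tau> s \<bullet> g (\<theta> s)) \<le> \<bar>\<Delta>\<bar> * \<bar>\<tau> s \<bullet> g (\<theta> s)\<bar>" by (simp add: abs_mult[symmetric])
    also have "\<dots> \<le> \<bar>\<Delta>\<bar> * (\<kappa> s * q)"
      using inner_tangent_le[OF nth orth] by (intro mult_left_mono) (auto simp: ntau q_def)
    also have "\<dots> = (\<bar>\<Delta>\<bar> * q) * \<kappa> s" by simp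
    also have "\<dots> \<le> (pi / 2 * q\<^sup>2 + \<Delta>\<^sup>2 / (2 * pi)) * \<kappa> s"
    proof (rule mult_right_mono)
      have "0 \<le> (pi * q - \<bar>\<Delta>\<bar>)\<^sup>2" by simp
      then have "2 * pi * (\<bar>\<Delta>\<bar> * q) \<le> pi\<^sup>2 * q\<^sup>2 + \<Delta>\<^sup>2"
        by (simp add: power2_eq_square algebra_simps)
      then show "\<bar>\<Delta>\<bar> * q \<le> pi / 2 * q\<^sup>2 + \<Delta>\<^sup>2 / (2 * pi)"
        by (simp add: field_simps power2_eq_square)
      show "0 \<le> \<kappa> s" using \<kappa>_pos[of s] by simp
    qed
    finally show "\<Delta> * (\<tau> s \<bullet> g (\<theta> s)) \<le> pi / 2 * (tan_energy g (\<theta> s) * \<kappa> s) + \<Delta>\<^sup>2 / (2 * pi) * \<kappa> s"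
      by (simp add: q algebra_simps)
  qed
  also have "\<Delta>\<^sup>2 / (2 * pi) * K \<le> \<Delta>\<^sup>2 / (2 * pi) * pi" by (rule mult_left_mono[OF K(2)]) simp
  finally have "\<Delta>\<^sup>2 \<le> pi * E" by (simp add: power2_eq_square)
  then have "ennreal (\<Delta>\<^sup>2) \<le> ennreal pi * ennreal E"
    by (simp add: ennreal_mult'[symmetric] ennreal_leI)
  also have "ennreal E = (\<integral>\<^sup>+s\<in>?I. ennreal (tan_energy g (\<theta> s) * \<kappa> s) \<partial>lborel)"
    by (rule nn_integral_has_integral_lebesgue'[symmetric, OF _ hasE])
       (use E_nonneg \<kappa>_pos in \<open>simp add: less_imp_le\<close>)
  finally show ?thesis
    by (simp add: \<Delta>_def \<theta>_def \<gamma>_def \<kappa>_def D_def)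
qed

section \<open>The Poincare inequality on the sphere\<close>

text \<open>Integrating over \<open>u\<close> gives \<open>E|u|\<close>, and \<open>1/|v|\<close> is independent of \<open>sgn v\<close>, so the left-hand side
  is \<open>E|u| E(1/|v|)\<close> times the mean of \<open>q (sgn v)\<close>. In dimension one \<open>E(1/|v|)\<close> is infinite.\<close>

lemma nn_integral_gauss_norm_quotient:
  fixes q :: "'a::euclidean_space \<Rightarrow> ennreal"
  assumes [measurable]: "q \<in> borel_measurable borel" and n: "DIM('a) \<ge> 2"
  shows "(\<integral>\<^sup>+u. \<integral>\<^sup>+v. q (sgn v) * ennreal (norm u / norm v) \<partial>gauss \<partial>(gauss::'a measure))
    \<le> 2 * (\<integral>\<^sup>+v. q (sgn v) \<partial>gauss)"
proof -
  let ?n = "DIM('a)"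
  let ?J = "gauss_moment (?n - 1)"
  let ?Q = "\<integral>\<^sup>+v. q (sgn v) \<partial>gauss"
  let ?N = "\<integral>\<^sup>+u. ennreal (norm u) \<partial>(gauss::'a measure)"
  let ?R = "\<integral>\<^sup>+v. ennreal (1 / norm v) * q (sgn v) \<partial>gauss"
  interpret prob_space "gauss :: 'a measure" by (rule prob_space_gauss)
  have "?N * ?J = (\<integral>\<^sup>+\<rho>. ennreal (\<rho> ^ (?n - 1) * exp (- \<rho>\<^sup>2)) * indicator {0<..} \<rho> * ennreal \<rho> \<partial>lborel)"
    using nn_integral_gauss_radial[of "\<lambda>r. ennreal r" "\<lambda>_::'a. 1"] emeasure_space_1 by simp
  also have "\<dots> = gauss_moment ?n"
    unfolding gauss_moment_def
    using n by (intro nn_integral_cong) (cases ?n, auto split: split_indicator simp: ennreal_mult'[symmetric] mult_ac)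
  finally have N: "?N * ?J = gauss_moment ?n" .
  have "?R * ?J = (\<integral>\<^sup>+\<rho>. ennreal (\<rho> ^ (?n - 1) * exp (- \<rho>\<^sup>2)) * indicator {0<..} \<rho> * ennreal (1 / \<rho>) \<partial>lborel) * ?Q"
    by (rule nn_integral_gauss_radial) measurable
  also have "(\<integral>\<^sup>+\<rho>. ennreal (\<rho> ^ (?n - 1) * exp (- \<rho>\<^sup>2)) * indicator {0<..} \<rho> * ennreal (1 / \<rho>) \<partial>lborel) = gauss_moment (?n - 2)"
  proof -
    obtain m where m: "?n = Suc (Suc m)" using n by (metis add_2_eq_Suc le_Suc_ex)
    show ?thesis
      unfolding gauss_moment_def m
      by (intro nn_integral_cong) (auto split: split_indicator simp: ennreal_mult'[symmetric])
  qed
  finally have R: "?R * ?J = gauss_moment (?n - 2) * ?Q" .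
  have "?J\<^sup>2 * (?N * ?R) = gauss_moment ?n * gauss_moment (?n - 2) * ?Q"
    using N R by (simp add: power2_eq_square mult_ac flip: N R)
  also have "\<dots> \<le> 2 * ?J\<^sup>2 * ?Q"
    by (rule mult_right_mono[OF gauss_moment_bound[OF n]]) simp
  also have "\<dots> = ?J\<^sup>2 * (2 * ?Q)" by (simp add: mult_ac)
  finally have le: "?N * ?R \<le> 2 * ?Q"
    using gauss_moment_pos[of "?n - 1"] gauss_moment_finite[of "?n - 1"]
    by (subst (asm) ennreal_mult_le_mult_iff) (auto simp: power2_eq_square ennreal_mult_eq_top_iff)
  have "(\<integral>\<^sup>+v. q (sgn v) * ennreal (norm u / norm v) \<partial>gauss) = ennreal (norm u) * ?R" for u :: 'a
  proof -
    have "(\<integral>\<^sup>+v. q (sgn v) * ennreal (norm u / norm v) \<partial>gauss) = (\<integral>\<^sup>+v. ennreal (norm u) * (ennreal (1 / norm v) * q (sgn v)) \<partial>gauss)"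
      by (intro nn_integral_cong) (simp add: ennreal_mult'[symmetric] mult.assoc[symmetric] mult.commute)
    also have "\<dots> = ennreal (norm u) * ?R" by (rule nn_integral_cmult) measurable
    finally show ?thesis .
  qed
  then have "(\<integral>\<^sup>+u. \<integral>\<^sup>+v. q (sgn v) * ennreal (norm u / norm v) \<partial>gauss \<partial>(gauss::'a measure)) = ?N * ?R"
    by (simp add: nn_integral_multc)
  with le show ?thesis by simp
qed

text \<open>The line spanned by \<open>x\<close> is a null set, and off this line \<open>gram y x\<close> is \<open>|x|\<^sup>2\<close> times the squared
  distance of \<open>y\<close> from it.\<close>

lemma AE_gram_pos:
  fixes x :: "'a::euclidean_space"
  assumes x: "x \<noteq> 0" and n: "DIM('a) \<ge> 2"
  shows "AE y in lborel. gram y x > 0"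
proof -
  have "negligible (span {x})"
    using n x by (intro negligible_lowdim) (simp add: dim_span)
  moreover have "span {x} \<in> sets borel" by (simp add: closed_subspace borel_closed)
  ultimately have "span {x} \<in> null_sets lborel"
    by (simp add: null_sets_def negligible_iff_emeasure0)
  then have "AE y in lborel. y \<notin> span {x}" by (rule AE_not_in)
  then show ?thesis
  proof eventually_elim
    fix y assume y: "y \<notin> span {x}"
    show "gram y x > 0"
    proof (rule ccontr)
      assume "\<not> gram y x > 0"
      then have 0: "gram y x = 0" using gram_nonneg[of y x] by simp
      define c where "c = (y \<bullet> x) / (x \<bullet> x)"
      have xx: "x \<bullet> x \<noteq> 0" using x by simp
      have "(y - c *\<^sub>R x) \<bullet> (y - c *\<^sub>R x) = gram y x / (x \<bullet> x)"
        using xx unfolding gram_def c_def power2_norm_eq_inner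
        by (simp add: inner_diff inner_commute[of x y] field_simps power2_eq_square)
      then have "y = c *\<^sub>R x" using 0 by simp
      then show False using y by (simp add: span_mul span_base)
    qed
  qed
qed

text \<open>Replace the independent pair \<open>(u, v)\<close> by the ends \<open>cos (\<pi>/4) y \<plusminus> sin (\<pi>/4) x\<close> of an arc, bound the
  squared increment by the energy of the arc, exchange integrations, and rotate each point of the arc back
  to its midpoint.\<close>

lemma sphere_poincare:
  fixes \<psi> :: "'a::euclidean_space \<Rightarrow> real" and g :: "'a \<Rightarrow> 'a"
  assumes der: "\<And>z. (\<psi> has_derivative (\<lambda>h. h \<bullet> g z)) (at z)"
    and cont: "continuous_on UNIV g"
    and n: "DIM('a) \<ge> 2"
  shows "(\<integral>\<^sup>+u. \<integral>\<^sup>+v. ennreal ((\<psi> (sgn u) - \<psi> (sgn v))\<^sup>2) \<partial>gauss \<partial>gauss)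
    \<le> ennreal (pi\<^sup>2) * (\<integral>\<^sup>+v. ennreal (tan_energy g (sgn v)) \<partial>gauss)"
proof -
  interpret prob_space "gauss :: 'a measure" by (rule prob_space_gauss)
  interpret gl: pair_sigma_finite "gauss :: 'a measure" "lborel :: real measure"
    by (simp add: pair_sigma_finite_def sigma_finite_measure_axioms sigma_finite_lborel)
  have "continuous_on UNIV \<psi>"
    by (intro continuous_at_imp_continuous_on ballI has_derivative_continuous[OF der])
  then have [measurable]: "\<psi> \<in> borel_measurable borel" by (rule borel_measurable_continuous_onI)
  have [measurable]: "g \<in> borel_measurable borel" using cont by (rule borel_measurable_continuous_onI)
  have [measurable]: "tan_energy g \<in> borel_measurable borel"
    unfolding tan_energy_def[abs_def] by measurable
  have [measurable]: "(\<lambda>p. gram (a p) (b p)) \<in> borel_measurable M"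
    if [measurable]: "a \<in> borel_measurable M" "b \<in> borel_measurable M" for a b :: "'c \<Rightarrow> 'a" and M
    unfolding gram_def by measurable
  have c45: "cos (pi/4) > 0" by (simp add: cos_45)
  let ?I = "{-(pi/4)..pi/4}"
  define K where "K x y s = ennreal (tan_energy g (sgn (cos s *\<^sub>R y + sin s *\<^sub>R x)) *
          (sqrt (gram y x) / (norm (cos s *\<^sub>R y + sin s *\<^sub>R x))\<^sup>2)) * indicator ?I s" for x y :: 'a and s
  have [measurable]: "(\<lambda>p. K (a p) (b p) (c p)) \<in> borel_measurable M"
    if [measurable]: "a \<in> borel_measurable M" "b \<in> borel_measurable M" "c \<in> borel_measurable M"
    for a b :: "'c \<Rightarrow> 'a" and c M
    unfolding K_def by measurable
  have "(\<integral>\<^sup>+u. \<integral>\<^sup>+v. ennreal ((\<psi> (sgn u) - \<psi> (sgn v))\<^sup>2) \<partial>gauss \<partial>gauss)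
      = (\<integral>\<^sup>+x. \<integral>\<^sup>+y. ennreal ((\<psi> (sgn (cos (pi/4) *\<^sub>R x + sin (pi/4) *\<^sub>R y))
          - \<psi> (sgn (cos (pi/4) *\<^sub>R y - sin (pi/4) *\<^sub>R x)))\<^sup>2) \<partial>gauss \<partial>gauss)"
    by (rule nn_integral_gauss_rotation[OF _ _ c45, symmetric]) simp_all
  also have "\<dots> \<le> (\<integral>\<^sup>+x. \<integral>\<^sup>+y. ennreal pi * (\<integral>\<^sup>+s. K x y s \<partial>lborel) \<partial>gauss \<partial>gauss)"
  proof (rule nn_integral_mono_AE, rule AE_mp[OF AE_gauss[OF AE_lborel_singleton[of 0]]], rule AE_I2, rule impI)
    fix x :: 'a assume x: "x \<noteq> 0"
    show "(\<integral>\<^sup>+y. ennreal ((\<psi> (sgn (cos (pi/4) *\<^sub>R x + sin (pi/4) *\<^sub>R y))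
          - \<psi> (sgn (cos (pi/4) *\<^sub>R y - sin (pi/4) *\<^sub>R x)))\<^sup>2) \<partial>gauss)
        \<le> (\<integral>\<^sup>+y. ennreal pi * (\<integral>\<^sup>+s. K x y s \<partial>lborel) \<partial>gauss)"
    proof (rule nn_integral_mono_AE, rule AE_mp[OF AE_gauss[OF AE_gram_pos[OF x n]]], rule AE_I2, rule impI)
      fix y :: 'a assume "gram y x > 0"
      from square_increment_le_energy_of_arc[OF der cont this]
      show "ennreal ((\<psi> (sgn (cos (pi/4) *\<^sub>R x + sin (pi/4) *\<^sub>R y))
          - \<psi> (sgn (cos (pi/4) *\<^sub>R y - sin (pi/4) *\<^sub>R x)))\<^sup>2) \<le> ennreal pi * (\<integral>\<^sup>+s. K x y s \<partial>lborel)"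
        by (simp add: K_def cos_45 sin_45 add.commute)
    qed
  qed
  also have "\<dots> = ennreal pi * (\<integral>\<^sup>+x. \<integral>\<^sup>+y. \<integral>\<^sup>+s. K x y s \<partial>lborel \<partial>gauss \<partial>gauss)"
    by (simp add: nn_integral_cmult)
  also have "(\<integral>\<^sup>+x. \<integral>\<^sup>+y. \<integral>\<^sup>+s. K x y s \<partial>lborel \<partial>gauss \<partial>gauss) = (\<integral>\<^sup>+x. \<integral>\<^sup>+s. \<integral>\<^sup>+y. K x y s \<partial>gauss \<partial>lborel \<partial>gauss)"
    by (intro nn_integral_cong gl.Fubini'[symmetric]) (simp add: case_prod_beta)
  also have "\<dots> = (\<integral>\<^sup>+s. \<integral>\<^sup>+x. \<integral>\<^sup>+y. K x y s \<partial>gauss \<partial>gauss \<partial>lborel)"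
    by (intro gl.Fubini'[symmetric]) (simp add: case_prod_beta)
  also have "\<dots> \<le> (\<integral>\<^sup>+s. (2 * (\<integral>\<^sup>+v. ennreal (tan_energy g (sgn v)) \<partial>gauss)) * indicator ?I s \<partial>lborel)"
  proof (rule nn_integral_mono)
    fix s :: real
    show "(\<integral>\<^sup>+x. \<integral>\<^sup>+y. K x y s \<partial>gauss \<partial>gauss) \<le> (2 * (\<integral>\<^sup>+v. ennreal (tan_energy g (sgn v)) \<partial>gauss)) * indicator ?I s"
    proof (cases "s \<in> ?I")
      case False then show ?thesis by (simp add: K_def)
    next
      case True
      have c: "cos s > 0" using True pi_gt_zero by (intro cos_gt_zero_pi; simp; linarith)
      have gr: "gram (cos s *\<^sub>R y + sin s *\<^sub>R x) (cos s *\<^sub>R x - sin s *\<^sub>R y) = gram y x" for x y :: 'a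
        by (rule gram_rotation) simp
      have "(\<integral>\<^sup>+x. \<integral>\<^sup>+y. K x y s \<partial>gauss \<partial>gauss)
          = (\<integral>\<^sup>+x. \<integral>\<^sup>+y. (\<lambda>u v. ennreal (tan_energy g (sgn v) * (sqrt (gram v u) / (norm v)\<^sup>2)))
               (cos s *\<^sub>R x + (- sin s) *\<^sub>R y) (cos s *\<^sub>R y - (- sin s) *\<^sub>R x) \<partial>gauss \<partial>gauss)"
        using True by (simp add: K_def gr)
      \<comment> \<open>The rotation by \<open>- s\<close> carries the point at parameter \<open>s\<close> to the second vector of the pair.\<close>
      also have "\<dots> = (\<integral>\<^sup>+u. \<integral>\<^sup>+v. ennreal (tan_energy g (sgn v) * (sqrt (gram v u) / (norm v)\<^sup>2)) \<partial>gauss \<partial>gauss)"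
        by (rule nn_integral_gauss_rotation) (simp_all add: c)
      also have "\<dots> \<le> (\<integral>\<^sup>+u. \<integral>\<^sup>+v. ennreal (tan_energy g (sgn v)) * ennreal (norm u / norm v) \<partial>gauss \<partial>(gauss::'a measure))"
      proof (rule nn_integral_mono, rule nn_integral_mono)
        fix u v :: 'a
        have T: "0 \<le> tan_energy g (sgn v)" by (rule tan_energy_nonneg) (simp add: norm_sgn)
        have "sqrt (gram v u) \<le> sqrt ((norm v * norm u)\<^sup>2)"
          by (intro real_sqrt_le_mono) (simp add: gram_def power_mult_distrib)
        then have "sqrt (gram v u) / (norm v)\<^sup>2 \<le> norm v * norm u / (norm v)\<^sup>2"
          by (intro divide_right_mono) simp_all
        also have "\<dots> = norm u / norm v" by (simp add: power2_eq_square)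
        finally have "tan_energy g (sgn v) * (sqrt (gram v u) / (norm v)\<^sup>2) \<le> tan_energy g (sgn v) * (norm u / norm v)"
          using T by (rule mult_left_mono)
        then show "ennreal (tan_energy g (sgn v) * (sqrt (gram v u) / (norm v)\<^sup>2))
            \<le> ennreal (tan_energy g (sgn v)) * ennreal (norm u / norm v)"
          using T by (simp add: ennreal_mult'[symmetric] ennreal_leI)
      qed
      also have "\<dots> \<le> 2 * (\<integral>\<^sup>+v. ennreal (tan_energy g (sgn v)) \<partial>gauss)"
        by (rule nn_integral_gauss_norm_quotient[OF _ n]) simp
      finally show ?thesis using True by simp
    qed
  qed
  also have "\<dots> = ennreal pi * (\<integral>\<^sup>+v. ennreal (tan_energy g (sgn v)) \<partial>gauss)"
  proof -
    have "2 * ennreal (pi / 2) = ennreal pi"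
      by (simp add: ennreal_mult'[symmetric] flip: ennreal_numeral)
    then show ?thesis by (subst nn_integral_cmult_indicator) (simp_all add: mult_ac, simp only: mult.assoc[symmetric])
  qed
  finally have "(\<integral>\<^sup>+u. \<integral>\<^sup>+v. ennreal ((\<psi> (sgn u) - \<psi> (sgn v))\<^sup>2) \<partial>gauss \<partial>gauss)
    \<le> ennreal pi * (ennreal pi * (\<integral>\<^sup>+v. ennreal (tan_energy g (sgn v)) \<partial>gauss))"
    by (simp add: mult_left_mono)
  then show ?thesis by (simp add: power2_eq_square ennreal_mult' mult_ac)
qed

section \<open>Variances on product spaces\<close>

lemma (in prob_space) integrable_bounded_by:
  fixes h :: "'a \<Rightarrow> real"
  assumes "h \<in> borel_measurable M" "\<And>x. \<bar>h x\<bar> \<le> C"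
  shows "integrable M h"
  using assms by (intro integrable_const_bound[where B=C]) auto

lemma (in prob_space) variance_eq_half_double_integral:
  fixes h :: "'a \<Rightarrow> real"
  assumes [measurable]: "h \<in> borel_measurable M" and C: "\<And>x. \<bar>h x\<bar> \<le> C"
  shows "(\<integral>\<^sup>+u. \<integral>\<^sup>+v. ennreal ((h u - h v)\<^sup>2) \<partial>M \<partial>M)
    = ennreal (2 * ((\<integral>x. (h x)\<^sup>2 \<partial>M) - (\<integral>x. h x \<partial>M)\<^sup>2))"
proof -
  let ?a = "\<integral>x. (h x)\<^sup>2 \<partial>M" and ?m = "\<integral>x. h x \<partial>M"
  have i1[simp]: "integrable M h" by (rule integrable_bounded_by) (auto intro: C)
  have C2: "\<bar>(h x)\<^sup>2\<bar> \<le> C\<^sup>2" for x using C[of x] by (simp add: abs_le_square_iff[symmetric])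
  have i2[simp]: "integrable M (\<lambda>x. (h x)\<^sup>2)" by (rule integrable_bounded_by[OF _ C2]) simp
  have e: "(h u - h v)\<^sup>2 = (h u)\<^sup>2 - 2 * h u * h v + (h v)\<^sup>2" for u v by (simp add: power2_diff)
  have inner: "(\<integral>v. (h u - h v)\<^sup>2 \<partial>M) = (h u)\<^sup>2 - 2 * h u * ?m + ?a" for u
    unfolding e by (simp add: prob_space)
  have "(\<integral>\<^sup>+u. \<integral>\<^sup>+v. ennreal ((h u - h v)\<^sup>2) \<partial>M \<partial>M) = (\<integral>\<^sup>+u. ennreal ((h u)\<^sup>2 - 2 * h u * ?m + ?a) \<partial>M)"
    by (intro nn_integral_cong, subst nn_integral_eq_integral) (simp_all add: inner, simp add: e)
  also have "\<dots> = ennreal (\<integral>u. (h u)\<^sup>2 - 2 * h u * ?m + ?a \<partial>M)"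
  proof (rule nn_integral_eq_integral)
    show "AE u in M. 0 \<le> (h u)\<^sup>2 - 2 * h u * ?m + ?a"
      unfolding inner[symmetric] by (intro AE_I2 integral_nonneg_AE) simp
  qed simp
  also have "(\<integral>u. (h u)\<^sup>2 - 2 * h u * ?m + ?a \<partial>M) = 2 * (?a - ?m\<^sup>2)"
    by (simp add: prob_space) (simp add: power2_eq_square)
  finally show ?thesis .
qed

text \<open>Let \<open>m\<close> and \<open>n\<close> be the conditional means of \<open>H\<close> given the second and the first variable, and
  let \<open>M\<close> be its mean. Expanding \<open>E (H - m - n + M)\<^sup>2 \<ge> 0\<close> gives \<open>E m\<^sup>2 + E n\<^sup>2 \<le> E H\<^sup>2 + M\<^sup>2\<close>, which is the
  claim rearranged.\<close>

lemma efron_stein_pair: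
  fixes H :: "'a \<Rightarrow> 'b \<Rightarrow> real"
  assumes "prob_space A" "prob_space B"
    and [measurable]: "case_prod H \<in> borel_measurable (A \<Otimes>\<^sub>M B)" and C: "\<And>x y. \<bar>H x y\<bar> \<le> C"
  shows "(\<integral>p. (H (fst p) (snd p))\<^sup>2 \<partial>(A \<Otimes>\<^sub>M B)) - (\<integral>p. H (fst p) (snd p) \<partial>(A \<Otimes>\<^sub>M B))\<^sup>2
    \<le> (\<integral>y. (\<integral>x. (H x y)\<^sup>2 \<partial>A) - (\<integral>x. H x y \<partial>A)\<^sup>2 \<partial>B)
      + (\<integral>x. (\<integral>y. (H x y)\<^sup>2 \<partial>B) - (\<integral>y. H x y \<partial>B)\<^sup>2 \<partial>A)"
    and "integrable B (\<lambda>y. (\<integral>x. (H x y)\<^sup>2 \<partial>A) - (\<integral>x. H x y \<partial>A)\<^sup>2)"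
    and "integrable A (\<lambda>x. (\<integral>y. (H x y)\<^sup>2 \<partial>B) - (\<integral>y. H x y \<partial>B)\<^sup>2)"
proof -
  interpret A: prob_space A by fact
  interpret B: prob_space B by fact
  interpret P: pair_prob_space A B ..
  let ?P = "A \<Otimes>\<^sub>M B"
  define m where "m y = (\<integral>x. H x y \<partial>A)" for y
  define n where "n x = (\<integral>y. H x y \<partial>B)" for x
  define M where "M = (\<integral>p. H (fst p) (snd p) \<partial>?P)"
  have C0: "C \<ge> 0" using C[of undefined undefined] by linarith
  have [measurable]: "m \<in> borel_measurable B" unfolding m_def by measurable
  have [measurable]: "n \<in> borel_measurable A" unfolding n_def by measurable
  have bound: "\<bar>a * b\<bar> \<le> C * C" if "\<bar>a\<bar> \<le> C" "\<bar>b\<bar> \<le> C" for a b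
    using that C0 by (simp add: abs_mult mult_mono)
  have HA[measurable]: "(\<lambda>x. H x y) \<in> borel_measurable A" if "y \<in> space B" for y
    using that by measurable
  have iA: "integrable A (\<lambda>x. H x y)" if "y \<in> space B" for y
    by (rule A.integrable_bounded_by[OF HA[OF that] C])
  have HB: "(\<lambda>y. H x y) \<in> borel_measurable B" if "x \<in> space A" for x
    using that by measurable
  have iB: "integrable B (\<lambda>y. H x y)" if "x \<in> space A" for x
    by (rule B.integrable_bounded_by[OF HB[OF that] C])
  have Cm: "\<bar>m y\<bar> \<le> C" for y
  proof (cases "integrable A (\<lambda>x. H x y)")
    case True
    have "\<bar>m y\<bar> \<le> (\<integral>x. \<bar>H x y\<bar> \<partial>A)" unfolding m_def by (rule integral_abs_bound)
    also have "\<dots> \<le> (\<integral>x. C \<partial>A)" using True C by (intro integral_mono) auto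
    finally show ?thesis by (simp add: A.prob_space)
  qed (simp add: m_def not_integrable_integral_eq C0)
  have Cn: "\<bar>n x\<bar> \<le> C" for x
  proof (cases "integrable B (\<lambda>y. H x y)")
    case True
    have "\<bar>n x\<bar> \<le> (\<integral>y. \<bar>H x y\<bar> \<partial>B)" unfolding n_def by (rule integral_abs_bound)
    also have "\<dots> \<le> (\<integral>y. C \<partial>B)" using True C by (intro integral_mono) auto
    finally show ?thesis by (simp add: B.prob_space)
  qed (simp add: n_def not_integrable_integral_eq C0)
  have intP: "integrable ?P k" if "k \<in> borel_measurable ?P" "\<And>p. \<bar>k p\<bar> \<le> C'" for k :: "_ \<Rightarrow> real" and C'
    using that by (intro P.P.integrable_bounded_by)
  have iH: "integrable ?P (\<lambda>p. H (fst p) (snd p))" by (rule intP[of _ C]) (simp_all add: C)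
  have im: "integrable ?P (\<lambda>p. m (snd p))" by (rule intP[of _ C]) (simp_all add: Cm)
  have inn: "integrable ?P (\<lambda>p. n (fst p))" by (rule intP[of _ C]) (simp_all add: Cn)
  have iHH: "integrable ?P (\<lambda>p. H (fst p) (snd p) * H (fst p) (snd p))" by (rule intP[of _ "C*C"]) (simp, rule bound, rule C, rule C)
  have iHm: "integrable ?P (\<lambda>p. H (fst p) (snd p) * m (snd p))" by (rule intP[of _ "C*C"]) (simp, rule bound, rule C, rule Cm)
  have iHn: "integrable ?P (\<lambda>p. H (fst p) (snd p) * n (fst p))" by (rule intP[of _ "C*C"]) (simp, rule bound, rule C, rule Cn)
  have imn: "integrable ?P (\<lambda>p. m (snd p) * n (fst p))" by (rule intP[of _ "C*C"]) (simp, rule bound, rule Cm, rule Cn)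
  have imm: "integrable ?P (\<lambda>p. m (snd p) * m (snd p))" by (rule intP[of _ "C*C"]) (simp, rule bound, rule Cm, rule Cm)
  have innn: "integrable ?P (\<lambda>p. n (fst p) * n (fst p))" by (rule intP[of _ "C*C"]) (simp, rule bound, rule Cn, rule Cn)
  have xy: "(\<integral>p. k (fst p) (snd p) \<partial>?P) = (\<integral>x. \<integral>y. k x y \<partial>B \<partial>A)"
    and yx: "(\<integral>p. k (fst p) (snd p) \<partial>?P) = (\<integral>y. \<integral>x. k x y \<partial>A \<partial>B)"
    and ixy: "integrable A (\<lambda>x. \<integral>y. k x y \<partial>B)"
    and iyx: "integrable B (\<lambda>y. \<integral>x. k x y \<partial>A)"
    if "integrable ?P (\<lambda>p. k (fst p) (snd p))" for k :: "'a \<Rightarrow> 'b \<Rightarrow> real"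
    using P.integral_fst'[OF that] P.integral_snd[of k] P.integrable_fst'[OF that] P.integrable_snd[of k] that
    by (simp_all add: case_prod_beta')
  define Q where "Q = (\<integral>p. H (fst p) (snd p) * H (fst p) (snd p) \<partial>?P)"
  define S where "S = (\<integral>y. m y * m y \<partial>B)"
  define T where "T = (\<integral>x. n x * n x \<partial>A)"
  have Em: "(\<integral>y. m y \<partial>B) = M" unfolding M_def m_def yx[OF iH] ..
  have En: "(\<integral>x. n x \<partial>A) = M" unfolding M_def n_def xy[OF iH] ..
  have eHm: "(\<integral>p. H (fst p) (snd p) * m (snd p) \<partial>?P) = S"
    unfolding yx[of "\<lambda>x y. H x y * m y", OF iHm] S_def
    by (intro Bochner_Integration.integral_cong refl) (simp add: m_def)
  have eHn: "(\<integral>p. H (fst p) (snd p) * n (fst p) \<partial>?P) = T"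
    unfolding xy[of "\<lambda>x y. H x y * n x", OF iHn] T_def
    by (intro Bochner_Integration.integral_cong refl) (simp add: n_def)
  have emn: "(\<integral>p. m (snd p) * n (fst p) \<partial>?P) = M * M"
    unfolding xy[of "\<lambda>x y. m y * n x", OF imn] by (simp add: Em En)
  have emm: "(\<integral>p. m (snd p) * m (snd p) \<partial>?P) = S"
    unfolding xy[of "\<lambda>x y. m y * m y", OF imm] by (simp add: S_def A.prob_space)
  have enn: "(\<integral>p. n (fst p) * n (fst p) \<partial>?P) = T"
    unfolding xy[of "\<lambda>x y. n x * n x", OF innn] by (simp add: T_def B.prob_space)
  have em: "(\<integral>p. m (snd p) \<partial>?P) = M"
    unfolding xy[of "\<lambda>x y. m y", OF im] by (simp add: Em A.prob_space)
  have en: "(\<integral>p. n (fst p) \<partial>?P) = M"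
    unfolding xy[of "\<lambda>x y. n x", OF inn] by (simp add: En B.prob_space)
  have "0 \<le> (\<integral>p. (H (fst p) (snd p) - m (snd p) - n (fst p) + M)\<^sup>2 \<partial>?P)" by simp
  also have "(\<lambda>p. (H (fst p) (snd p) - m (snd p) - n (fst p) + M)\<^sup>2) = (\<lambda>p. H (fst p) (snd p) * H (fst p) (snd p)
      + m (snd p) * m (snd p) + n (fst p) * n (fst p) + M * M - 2 * (H (fst p) (snd p) * m (snd p))
      - 2 * (H (fst p) (snd p) * n (fst p)) + (2 * M) * H (fst p) (snd p) + 2 * (m (snd p) * n (fst p))
      - (2 * M) * m (snd p) - (2 * M) * n (fst p))"
    by (simp add: fun_eq_iff power2_eq_square algebra_simps)
  also have "(\<integral>p. \<dots> p \<partial>?P) = Q + S + T + M * M - 2 * S - 2 * T + 2 * M * M + 2 * (M * M) - 2 * M * M - 2 * M * M"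
    using iH im inn iHH iHm iHn imn imm innn
    by (simp add: eHm eHn emn emm enn em en Q_def[symmetric] M_def[symmetric] P.P.prob_space)
  finally have main: "S + T \<le> Q + M * M" by simp
  have i1: "integrable B (\<lambda>y. \<integral>x. (H x y)\<^sup>2 \<partial>A)" "integrable A (\<lambda>x. \<integral>y. (H x y)\<^sup>2 \<partial>B)"
    using iyx[of "\<lambda>x y. H x y * H x y", OF iHH] ixy[of "\<lambda>x y. H x y * H x y", OF iHH] by (simp_all add: power2_eq_square)
  have i2: "integrable B (\<lambda>y. (m y)\<^sup>2)" "integrable A (\<lambda>x. (n x)\<^sup>2)"
    using iyx[of "\<lambda>x y. m y * m y", OF imm] ixy[of "\<lambda>x y. n x * n x", OF innn]
    by (simp_all add: power2_eq_square A.prob_space B.prob_space)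
  show "integrable B (\<lambda>y. (\<integral>x. (H x y)\<^sup>2 \<partial>A) - (\<integral>x. H x y \<partial>A)\<^sup>2)"
    "integrable A (\<lambda>x. (\<integral>y. (H x y)\<^sup>2 \<partial>B) - (\<integral>y. H x y \<partial>B)\<^sup>2)"
    using i1 i2 by (auto simp: m_def n_def)
  have "(\<integral>y. (\<integral>x. (H x y)\<^sup>2 \<partial>A) - (m y)\<^sup>2 \<partial>B) = Q - S"
    using i1 i2 yx[of "\<lambda>x y. H x y * H x y", OF iHH] by (simp add: Q_def S_def power2_eq_square)
  moreover have "(\<integral>x. (\<integral>y. (H x y)\<^sup>2 \<partial>B) - (n x)\<^sup>2 \<partial>A) = Q - T"
    using i1 i2 xy[of "\<lambda>x y. H x y * H x y", OF iHH] by (simp add: Q_def T_def power2_eq_square)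
  ultimately show "(\<integral>p. (H (fst p) (snd p))\<^sup>2 \<partial>?P) - (\<integral>p. H (fst p) (snd p) \<partial>?P)\<^sup>2
    \<le> (\<integral>y. (\<integral>x. (H x y)\<^sup>2 \<partial>A) - (\<integral>x. H x y \<partial>A)\<^sup>2 \<partial>B)
      + (\<integral>x. (\<integral>y. (H x y)\<^sup>2 \<partial>B) - (\<integral>y. H x y \<partial>B)\<^sup>2 \<partial>A)"
    using main by (simp add: m_def[symmetric] n_def[symmetric] M_def[symmetric] Q_def power2_eq_square)
qed

lemma (in prob_space) variance_nonneg:
  fixes h :: "'a \<Rightarrow> real"
  assumes [measurable]: "h \<in> borel_measurable M" and C: "\<And>x. \<bar>h x\<bar> \<le> C"
  shows "0 \<le> (\<integral>x. (h x)\<^sup>2 \<partial>M) - (\<integral>x. h x \<partial>M)\<^sup>2"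
proof -
  have i: "integrable M h" by (rule integrable_bounded_by) (auto intro: C)
  have "\<bar>(h x)\<^sup>2\<bar> \<le> C\<^sup>2" for x using C[of x] by (simp add: abs_le_square_iff[symmetric])
  then have i2: "integrable M (\<lambda>x. (h x)\<^sup>2)" by (intro integrable_bounded_by) simp_all
  show ?thesis using variance_eq[OF i i2] variance_positive[of h] by simp
qed

section \<open>From rays and spheres to the whole space\<close>

text \<open>The law \<open>D\<close> is that of \<open>r \<theta>\<close> with independent \<open>r\<close> and uniform \<open>\<theta>\<close>. In the Efron-Stein bound, the
  rays cost \<open>W r\<close> times the radial part \<open>a\<close> of the squared gradient \<open>b\<close>, and the spheres cost
  \<open>(\<pi>\<^sup>2/2) r\<^sup>2\<close> times the tangential part \<open>b - a\<close>.\<close>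

lemma variance_radial_le:
  fixes \<psi> :: "'a::euclidean_space \<Rightarrow> real" and g :: "'a \<Rightarrow> 'a" and \<nu> :: "real measure"
  assumes \<nu>: "prob_space \<nu>" and sets_\<nu>[measurable_cong]: "sets \<nu> = sets borel" and \<nu>_pos: "AE r in \<nu>. 0 < r"
    and der: "\<And>z. (\<psi> has_derivative (\<lambda>h. h \<bullet> g z)) (at z)"
    and cont: "continuous_on UNIV g"
    and C: "\<And>x. \<bar>\<psi> x\<bar> \<le> C"
    and n: "DIM('a) \<ge> 2"
    and W[measurable]: "W \<in> borel_measurable borel" and W0: "\<And>r. 0 \<le> W r"
    and ray: "\<And>\<theta>. ennreal ((\<integral>r. (\<psi> (r *\<^sub>R \<theta>))\<^sup>2 \<partial>\<nu>) - (\<integral>r. \<psi> (r *\<^sub>R \<theta>) \<partial>\<nu>)\<^sup>2)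
        \<le> (\<integral>\<^sup>+r. ennreal (W r * (\<theta> \<bullet> g (r *\<^sub>R \<theta>))\<^sup>2) \<partial>\<nu>)"
    and D: "D = distr (\<nu> \<Otimes>\<^sub>M gauss) borel (\<lambda>p. fst p *\<^sub>R sgn (snd p))"
  shows "ennreal ((\<integral>x. (\<psi> x)\<^sup>2 \<partial>D) - (\<integral>x. \<psi> x \<partial>D)\<^sup>2)
    \<le> (\<integral>\<^sup>+x. ennreal (max (W (norm x)) (pi\<^sup>2 / 2 * (norm x)\<^sup>2) * (norm (g x))\<^sup>2) \<partial>D)"
proof -
  let ?\<mu> = "gauss :: 'a measure"
  interpret A: prob_space \<nu> by fact
  interpret B: prob_space ?\<mu> by (rule prob_space_gauss)
  interpret P: pair_prob_space \<nu> ?\<mu> ..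
  have "continuous_on UNIV \<psi>"
    by (intro continuous_at_imp_continuous_on ballI has_derivative_continuous[OF der])
  then have [measurable]: "\<psi> \<in> borel_measurable borel" by (rule borel_measurable_continuous_onI)
  have [measurable]: "g \<in> borel_measurable borel" using cont by (rule borel_measurable_continuous_onI)
  define H where "H r z = \<psi> (r *\<^sub>R sgn z)" for r and z :: 'a
  define a where "a r z = (sgn z \<bullet> g (r *\<^sub>R sgn z))\<^sup>2" for r and z :: 'a
  define b where "b r z = (norm (g (r *\<^sub>R sgn z)))\<^sup>2" for r and z :: 'a
  have [measurable]: "case_prod H \<in> borel_measurable (\<nu> \<Otimes>\<^sub>M ?\<mu>)" unfolding H_def by measurable
  have [measurable]: "case_prod a \<in> borel_measurable (\<nu> \<Otimes>\<^sub>M ?\<mu>)" unfolding a_def by measurable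
  have [measurable]: "case_prod b \<in> borel_measurable (\<nu> \<Otimes>\<^sub>M ?\<mu>)" unfolding b_def by measurable
  have ab: "0 \<le> a r z" "a r z \<le> b r z" for r z
    using tan_energy_nonneg[of "sgn z" "\<lambda>_. g (r *\<^sub>R sgn z)"]
    by (simp_all add: a_def b_def tan_energy_def norm_sgn)
  have HC: "\<bar>H r z\<bar> \<le> C" for r z by (simp add: H_def C)
  note ES = efron_stein_pair[OF \<nu> prob_space_gauss, of H C, OF _ HC, simplified]
  have sphere: "ennreal ((\<integral>z. (H r z)\<^sup>2 \<partial>?\<mu>) - (\<integral>z. H r z \<partial>?\<mu>)\<^sup>2)
      \<le> (\<integral>\<^sup>+z. ennreal (pi\<^sup>2 / 2 * r\<^sup>2 * (b r z - a r z)) \<partial>?\<mu>)" for r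
  proof -
    have der_r: "((\<lambda>x. \<psi> (r *\<^sub>R x)) has_derivative (\<lambda>h. h \<bullet> (r *\<^sub>R g (r *\<^sub>R z)))) (at z)" for z
    proof -
      have "((\<lambda>x. r *\<^sub>R x) has_derivative (\<lambda>h. r *\<^sub>R h)) (at z)" by (auto intro!: derivative_eq_intros)
      from has_derivative_compose[OF this der] show ?thesis by simp
    qed
    have "continuous_on UNIV (\<lambda>z. r *\<^sub>R g (r *\<^sub>R z))"
      by (intro continuous_intros continuous_on_compose2[OF cont]) auto
    note sphere_poincare[OF der_r this n]
    moreover have "tan_energy (\<lambda>z. r *\<^sub>R g (r *\<^sub>R z)) (sgn v) = r\<^sup>2 * (b r v - a r v)" for v
      by (simp add: tan_energy_def a_def b_def power_mult_distrib algebra_simps)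
    moreover have Hm: "H r \<in> borel_measurable ?\<mu>" unfolding H_def by measurable
    ultimately have "ennreal (2 * ((\<integral>z. (H r z)\<^sup>2 \<partial>?\<mu>) - (\<integral>z. H r z \<partial>?\<mu>)\<^sup>2))
      \<le> ennreal (pi\<^sup>2) * (\<integral>\<^sup>+z. ennreal (r\<^sup>2 * (b r z - a r z)) \<partial>?\<mu>)"
      using B.variance_eq_half_double_integral[OF Hm HC] by (simp add: H_def)
    then have "ennreal (1/2) * ennreal (2 * ((\<integral>z. (H r z)\<^sup>2 \<partial>?\<mu>) - (\<integral>z. H r z \<partial>?\<mu>)\<^sup>2))
      \<le> ennreal (1/2) * (ennreal (pi\<^sup>2) * (\<integral>\<^sup>+z. ennreal (r\<^sup>2 * (b r z - a r z)) \<partial>?\<mu>))"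
      by (rule mult_left_mono) simp
    also have "ennreal (1/2) * ennreal (2 * ((\<integral>z. (H r z)\<^sup>2 \<partial>?\<mu>) - (\<integral>z. H r z \<partial>?\<mu>)\<^sup>2))
        = ennreal ((\<integral>z. (H r z)\<^sup>2 \<partial>?\<mu>) - (\<integral>z. H r z \<partial>?\<mu>)\<^sup>2)"
      by (subst ennreal_mult'[symmetric]) (simp_all add: diff_divide_distrib)
    also have "ennreal (1/2) * (ennreal (pi\<^sup>2) * (\<integral>\<^sup>+z. ennreal (r\<^sup>2 * (b r z - a r z)) \<partial>?\<mu>))
        = ennreal (pi\<^sup>2 / 2) * (\<integral>\<^sup>+z. ennreal (r\<^sup>2 * (b r z - a r z)) \<partial>?\<mu>)"
    proof -
      have "ennreal (1/2) * ennreal (pi\<^sup>2) = ennreal (pi\<^sup>2 / 2)"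
        by (subst ennreal_mult'[symmetric]) simp_all
      then show ?thesis by (simp only: mult.assoc[symmetric])
    qed
    also have "\<dots> = (\<integral>\<^sup>+z. ennreal (pi\<^sup>2 / 2) * ennreal (r\<^sup>2 * (b r z - a r z)) \<partial>?\<mu>)"
      by (rule nn_integral_cmult[symmetric]) (simp add: a_def b_def)
    finally show ?thesis by (simp add: ennreal_mult'[symmetric] mult.assoc)
  qed
  have integral_D: "(\<integral>x. k x \<partial>D) = (\<integral>p. k (fst p *\<^sub>R sgn (snd p)) \<partial>(\<nu> \<Otimes>\<^sub>M ?\<mu>))"
    if [measurable]: "k \<in> borel_measurable borel" for k :: "'a \<Rightarrow> real"
    unfolding D by (subst integral_distr) auto
  have "ennreal ((\<integral>x. (\<psi> x)\<^sup>2 \<partial>D) - (\<integral>x. \<psi> x \<partial>D)\<^sup>2)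
      \<le> ennreal ((\<integral>z. (\<integral>r. (H r z)\<^sup>2 \<partial>\<nu>) - (\<integral>r. H r z \<partial>\<nu>)\<^sup>2 \<partial>?\<mu>)
        + (\<integral>r. (\<integral>z. (H r z)\<^sup>2 \<partial>?\<mu>) - (\<integral>z. H r z \<partial>?\<mu>)\<^sup>2 \<partial>\<nu>))"
  proof -
    have "(\<integral>x. (\<psi> x)\<^sup>2 \<partial>D) = (\<integral>p. (H (fst p) (snd p))\<^sup>2 \<partial>(\<nu> \<Otimes>\<^sub>M ?\<mu>))"
      "(\<integral>x. \<psi> x \<partial>D) = (\<integral>p. H (fst p) (snd p) \<partial>(\<nu> \<Otimes>\<^sub>M ?\<mu>))"
      by (simp_all add: integral_D H_def)
    then show ?thesis using ES(1) by (intro ennreal_leI) (simp only:)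
  qed
  also have "\<dots> = ennreal (\<integral>z. (\<integral>r. (H r z)\<^sup>2 \<partial>\<nu>) - (\<integral>r. H r z \<partial>\<nu>)\<^sup>2 \<partial>?\<mu>)
        + ennreal (\<integral>r. (\<integral>z. (H r z)\<^sup>2 \<partial>?\<mu>) - (\<integral>z. H r z \<partial>?\<mu>)\<^sup>2 \<partial>\<nu>)"
    by (intro ennreal_plus integral_nonneg_AE AE_I2 A.variance_nonneg[OF _ HC] B.variance_nonneg[OF _ HC])
       (auto simp: H_def)
  also have "ennreal (\<integral>z. (\<integral>r. (H r z)\<^sup>2 \<partial>\<nu>) - (\<integral>r. H r z \<partial>\<nu>)\<^sup>2 \<partial>?\<mu>)
      = (\<integral>\<^sup>+z. ennreal ((\<integral>r. (H r z)\<^sup>2 \<partial>\<nu>) - (\<integral>r. H r z \<partial>\<nu>)\<^sup>2) \<partial>?\<mu>)"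
    by (intro nn_integral_eq_integral[symmetric] ES(2) AE_I2 A.variance_nonneg[OF _ HC]) (auto simp: H_def)
  also have "ennreal (\<integral>r. (\<integral>z. (H r z)\<^sup>2 \<partial>?\<mu>) - (\<integral>z. H r z \<partial>?\<mu>)\<^sup>2 \<partial>\<nu>)
      = (\<integral>\<^sup>+r. ennreal ((\<integral>z. (H r z)\<^sup>2 \<partial>?\<mu>) - (\<integral>z. H r z \<partial>?\<mu>)\<^sup>2) \<partial>\<nu>)"
    by (intro nn_integral_eq_integral[symmetric] ES(3) AE_I2 B.variance_nonneg[OF _ HC]) (auto simp: H_def)
  also have "(\<integral>\<^sup>+z. ennreal ((\<integral>r. (H r z)\<^sup>2 \<partial>\<nu>) - (\<integral>r. H r z \<partial>\<nu>)\<^sup>2) \<partial>?\<mu>)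
        + (\<integral>\<^sup>+r. ennreal ((\<integral>z. (H r z)\<^sup>2 \<partial>?\<mu>) - (\<integral>z. H r z \<partial>?\<mu>)\<^sup>2) \<partial>\<nu>)
      \<le> (\<integral>\<^sup>+z. \<integral>\<^sup>+r. ennreal (W r * a r z) \<partial>\<nu> \<partial>?\<mu>) + (\<integral>\<^sup>+r. \<integral>\<^sup>+z. ennreal (pi\<^sup>2 / 2 * r\<^sup>2 * (b r z - a r z)) \<partial>?\<mu> \<partial>\<nu>)"
    by (intro add_mono nn_integral_mono sphere) (simp add: H_def a_def ray)
  also have "(\<integral>\<^sup>+z. \<integral>\<^sup>+r. ennreal (W r * a r z) \<partial>\<nu> \<partial>?\<mu>) = (\<integral>\<^sup>+r. \<integral>\<^sup>+z. ennreal (W r * a r z) \<partial>?\<mu> \<partial>\<nu>)"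
    by (intro P.Fubini') simp
  also have "\<dots> + (\<integral>\<^sup>+r. \<integral>\<^sup>+z. ennreal (pi\<^sup>2 / 2 * r\<^sup>2 * (b r z - a r z)) \<partial>?\<mu> \<partial>\<nu>)
      = (\<integral>\<^sup>+r. \<integral>\<^sup>+z. ennreal (W r * a r z) + ennreal (pi\<^sup>2 / 2 * r\<^sup>2 * (b r z - a r z)) \<partial>?\<mu> \<partial>\<nu>)"
    unfolding a_def b_def
    by (subst nn_integral_add[symmetric], measurable)
       (intro nn_integral_cong, subst nn_integral_add[symmetric], measurable)
  also have "\<dots> \<le> (\<integral>\<^sup>+r. \<integral>\<^sup>+z. ennreal (max (W r) (pi\<^sup>2 / 2 * r\<^sup>2) * b r z) \<partial>?\<mu> \<partial>\<nu>)"
  proof (intro nn_integral_mono)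
    fix r and z :: 'a
    let ?m = "max (W r) (pi\<^sup>2 / 2 * r\<^sup>2)"
    have "W r * a r z + pi\<^sup>2 / 2 * r\<^sup>2 * (b r z - a r z) \<le> ?m * a r z + ?m * (b r z - a r z)"
      using ab[of r z] by (intro add_mono mult_right_mono) auto
    also have "\<dots> = ?m * b r z" by (simp add: algebra_simps)
    finally show "ennreal (W r * a r z) + ennreal (pi\<^sup>2 / 2 * r\<^sup>2 * (b r z - a r z)) \<le> ennreal (?m * b r z)"
      using ab[of r z] W0[of r] by (simp add: ennreal_plus[symmetric] ennreal_leI del: ennreal_plus)
  qed
  also have "\<dots> = (\<integral>\<^sup>+r. \<integral>\<^sup>+z. ennreal (max (W (norm (r *\<^sub>R sgn z))) (pi\<^sup>2 / 2 * (norm (r *\<^sub>R sgn z))\<^sup>2)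
        * (norm (g (r *\<^sub>R sgn z)))\<^sup>2) \<partial>?\<mu> \<partial>\<nu>)"
  proof (rule nn_integral_cong_AE, use \<nu>_pos in eventually_elim)
    fix r :: real assume r: "0 < r"
    show "(\<integral>\<^sup>+z. ennreal (max (W r) (pi\<^sup>2 / 2 * r\<^sup>2) * b r z) \<partial>?\<mu>)
      = (\<integral>\<^sup>+z. ennreal (max (W (norm (r *\<^sub>R sgn z))) (pi\<^sup>2 / 2 * (norm (r *\<^sub>R sgn z))\<^sup>2) * (norm (g (r *\<^sub>R sgn z)))\<^sup>2) \<partial>?\<mu>)"
      by (rule nn_integral_cong_AE, use AE_gauss[OF AE_lborel_singleton[of 0]] in eventually_elim)
         (use r in \<open>simp add: b_def norm_sgn\<close>)
  qed
  also have "\<dots> = (\<integral>\<^sup>+x. ennreal (max (W (norm x)) (pi\<^sup>2 / 2 * (norm x)\<^sup>2) * (norm (g x))\<^sup>2) \<partial>D)"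
  proof -
    let ?F = "\<lambda>x. ennreal (max (W (norm x)) (pi\<^sup>2 / 2 * (norm x)\<^sup>2) * (norm (g x))\<^sup>2)"
    have "(\<integral>\<^sup>+x. ?F x \<partial>D) = (\<integral>\<^sup>+p. ?F (fst p *\<^sub>R sgn (snd p)) \<partial>(\<nu> \<Otimes>\<^sub>M ?\<mu>))"
      unfolding D by (rule nn_integral_distr) measurable
    also have "\<dots> = (\<integral>\<^sup>+r. \<integral>\<^sup>+z. ?F (fst (r, z) *\<^sub>R sgn (snd (r, z))) \<partial>?\<mu> \<partial>\<nu>)"
      by (rule B.nn_integral_fst[symmetric]) measurable
    finally show ?thesis by simp
  qed
  finally show ?thesis .
qed

section \<open>Smooth functions\<close>

lemma Ck_on_cong:
  "(\<And>x. x \<in> S \<Longrightarrow> f x = g x) \<Longrightarrow> Ck_on k S f \<longleftrightarrow> Ck_on k S g"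
proof (induction k arbitrary: f g)
  case 0
  then show ?case by (simp cong: continuous_on_cong)
next
  case (Suc k)
  have d: "(f has_derivative D) (at x within S) \<longleftrightarrow> (g has_derivative D) (at x within S)" if "x \<in> S" for x D
    using Suc.prems that by (metis has_derivative_transform)
  then have "f differentiable_on S \<longleftrightarrow> g differentiable_on S"
    by (auto simp: differentiable_on_def differentiable_def)
  moreover have "frechet_derivative f (at x within S) v = frechet_derivative g (at x within S) v" if "x \<in> S" for x v
    using d[OF that] by (simp add: frechet_derivative_def)
  then have "Ck_on k S (\<lambda>x. frechet_derivative f (at x within S) v)
      \<longleftrightarrow> Ck_on k S (\<lambda>x. frechet_derivative g (at x within S) v)" for v
    by (intro Suc.IH)
  ultimately show ?case by simp
qed

text \<open>On an open set the derivative within the set is the derivative, so any derivative found by the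
  usual rules may serve as the next one in the recursion for \<open>Ck_on\<close>.\<close>

lemma Ck_on_SucI:
  assumes "open S"
    and "\<And>x. x \<in> S \<Longrightarrow> (f has_derivative f' x) (at x)"
    and "\<And>v. Ck_on k S (\<lambda>x. f' x v)"
  shows "Ck_on (Suc k) S f"
proof -
  have w: "(f has_derivative f' x) (at x within S)" if "x \<in> S" for x
    using assms(2)[OF that] by (rule has_derivative_at_withinI)
  have "frechet_derivative f (at x within S) = f' x" if "x \<in> S" for x
    using frechet_derivative_at[OF assms(2)[OF that]] at_within_open[OF that \<open>open S\<close>] by simp
  then have "Ck_on k S (\<lambda>x. frechet_derivative f (at x within S) v)" for v
    using assms(3)[of v] by (subst Ck_on_cong[where g = "\<lambda>x. f' x v"]) auto
  moreover have "f differentiable_on S"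
    using w by (auto simp: differentiable_on_def differentiable_def)
  ultimately show ?thesis by simp
qed

lemma Ck_on_SucD:
  assumes "open S" "Ck_on (Suc k) S f"
  shows "\<And>x. x \<in> S \<Longrightarrow> (f has_derivative frechet_derivative f (at x within S)) (at x)"
    and "\<And>v. Ck_on k S (\<lambda>x. frechet_derivative f (at x within S) v)"
proof -
  fix x assume x: "x \<in> S"
  have "f differentiable (at x within S)" using assms(2) x by (auto simp: differentiable_on_def)
  then show "(f has_derivative frechet_derivative f (at x within S)) (at x)"
    using at_within_open[OF x \<open>open S\<close>] by (simp add: frechet_derivative_works[symmetric])
qed (use assms in simp)

lemma Ck_on_mono: "Ck_on (Suc k) S f \<Longrightarrow> Ck_on k S f"
  by (induction k arbitrary: f) (auto intro: differentiable_imp_continuous_on)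

lemma Ck_on_const: "open S \<Longrightarrow> Ck_on k S (\<lambda>_. c)"
proof (induction k arbitrary: c)
  case (Suc k)
  then show ?case by (intro Ck_on_SucI[where f' = "\<lambda>_ _. 0"]) auto
qed simp

lemma Ck_on_add: "open S \<Longrightarrow> Ck_on k S f \<Longrightarrow> Ck_on k S g \<Longrightarrow> Ck_on k S (\<lambda>x. f x + g x)"
proof (induction k arbitrary: f g)
  case (Suc k)
  show ?case
    by (rule Ck_on_SucI[OF Suc.prems(1) has_derivative_add[OF Ck_on_SucD(1)[OF Suc.prems(1,2)] Ck_on_SucD(1)[OF Suc.prems(1,3)]]])
       (assumption+, intro Suc.IH Suc.prems(1) Ck_on_SucD(2)[OF Suc.prems(1,2)] Ck_on_SucD(2)[OF Suc.prems(1,3)])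
qed (auto intro: continuous_intros)

lemma Ck_on_mult: "open S \<Longrightarrow> Ck_on k S f \<Longrightarrow> Ck_on k S g \<Longrightarrow> Ck_on k S (\<lambda>x. f x * g x)"
proof (induction k arbitrary: f g)
  case (Suc k)
  show ?case
    by (rule Ck_on_SucI[OF Suc.prems(1) has_derivative_mult[OF Ck_on_SucD(1)[OF Suc.prems(1,2)] Ck_on_SucD(1)[OF Suc.prems(1,3)]]])
       (assumption+, intro Ck_on_add Suc.IH Suc.prems(1) Ck_on_SucD(2)[OF Suc.prems(1,2)] Ck_on_SucD(2)[OF Suc.prems(1,3)]
          Ck_on_mono[OF Suc.prems(2)] Ck_on_mono[OF Suc.prems(3)])
qed (auto intro: continuous_intros)

text \<open>Sine and cosine are treated together because each is the derivative of the other up to sign.\<close>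

lemma Ck_on_sin_cos:
  "open S \<Longrightarrow> Ck_on k S f \<Longrightarrow> Ck_on k S (\<lambda>x. sin (f x)) \<and> Ck_on k S (\<lambda>x. cos (f x))"
proof (induction k arbitrary: f)
  case (Suc k)
  note op = Suc.prems(1)
  note d = Ck_on_SucD(1)[OF op Suc.prems(2)] and d2 = Ck_on_SucD(2)[OF op Suc.prems(2)]
  note IH = Suc.IH[OF op Ck_on_mono[OF Suc.prems(2)]]
  have "Ck_on (Suc k) S (\<lambda>x. sin (f x))"
  proof (rule Ck_on_SucI[OF op])
    show "((\<lambda>x. sin (f x)) has_derivative (\<lambda>v. cos (f x) * frechet_derivative f (at x within S) v)) (at x)"
      if "x \<in> S" for x
      using d[OF that] by (auto intro!: derivative_eq_intros simp: mult.commute)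
  qed (intro Ck_on_mult op d2 conjunct2[OF IH])
  moreover have "Ck_on (Suc k) S (\<lambda>x. cos (f x))"
  proof (rule Ck_on_SucI[OF op])
    show "((\<lambda>x. cos (f x)) has_derivative (\<lambda>v. (- 1 * sin (f x)) * frechet_derivative f (at x within S) v)) (at x)"
      if "x \<in> S" for x
      using d[OF that] by (auto intro!: derivative_eq_intros simp: mult.commute)
  qed (intro Ck_on_mult op d2 conjunct1[OF IH] Ck_on_const)
  ultimately show ?case ..
qed (auto intro: continuous_intros)

lemma Ck_on_ray:
  fixes f :: "'a::real_normed_vector \<Rightarrow> real"
  shows "Ck_on k UNIV f \<Longrightarrow> open S \<Longrightarrow> Ck_on k S (\<lambda>r. f (r *\<^sub>R \<theta>))"
proof (induction k arbitrary: f)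
  case 0
  then show ?case by (auto intro!: continuous_intros continuous_on_compose2[of UNIV f])
next
  case (Suc k)
  let ?D = "\<lambda>x. frechet_derivative f (at x within UNIV)"
  note d = Ck_on_SucD[OF open_UNIV Suc.prems(1)]
  show ?case
  proof (rule Ck_on_SucI[OF Suc.prems(2)])
    fix r :: real
    have "((\<lambda>r. r *\<^sub>R \<theta>) has_derivative (\<lambda>h. h *\<^sub>R \<theta>)) (at r)" by (auto intro!: derivative_eq_intros)
    from has_derivative_compose[OF this d(1)]
    have "((\<lambda>r. f (r *\<^sub>R \<theta>)) has_derivative (\<lambda>h. ?D (r *\<^sub>R \<theta>) (h *\<^sub>R \<theta>))) (at r)" by simp
    moreover have "linear (?D (r *\<^sub>R \<theta>))" by (rule has_derivative_linear[OF d(1)[OF UNIV_I]])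
    ultimately show "((\<lambda>r. f (r *\<^sub>R \<theta>)) has_derivative (\<lambda>h. h * ?D (r *\<^sub>R \<theta>) \<theta>)) (at r)"
      by (simp add: linear_cmul)
  next
    fix v :: real
    show "Ck_on k S (\<lambda>r. v * ?D (r *\<^sub>R \<theta>) \<theta>)"
      by (intro Ck_on_mult Ck_on_const Suc.prems Suc.IH d(2))
  qed
qed

lemma smooth_on_ray: "smooth_on UNIV f \<Longrightarrow> open S \<Longrightarrow> smooth_on S (\<lambda>r. f (r *\<^sub>R \<theta>))"
  unfolding smooth_on_def using Ck_on_ray by blast

lemma smooth_on_sin_scaled: "smooth_on S f \<Longrightarrow> open S \<Longrightarrow> smooth_on S (\<lambda>x. c * sin (d * f x))"
  unfolding smooth_on_def by (intro allI Ck_on_mult Ck_on_const Ck_on_sin_cos[THEN conjunct1]) auto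

lemma gradient_eqI:
  fixes f :: "'a::euclidean_space \<Rightarrow> real"
  assumes "(f has_derivative (\<lambda>h. h \<bullet> G)) (at x)"
  shows "gradient f x = G"
  unfolding gradient_def gderiv_def
proof (rule the_equality[where P = "\<lambda>E. (f has_derivative (\<lambda>h. h \<bullet> E)) (at x)", OF assms])
  fix E assume "(f has_derivative (\<lambda>h. h \<bullet> E)) (at x)"
  from has_derivative_unique[OF this assms] have "h \<bullet> E = h \<bullet> G" for h by metis
  then show "E = G" by (intro vector_eq_rdot[THEN iffD1]) (simp add: inner_commute)
qed
lemma smooth_gradient:
  fixes f :: "'a::euclidean_space \<Rightarrow> real"
  assumes "smooth_on UNIV f"
  shows "(f has_derivative (\<lambda>h. h \<bullet> gradient f x)) (at x)"
    and "continuous_on UNIV (gradient f)"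
proof -
  let ?D = "\<lambda>x. frechet_derivative f (at x within UNIV)"
  let ?G = "\<lambda>x. \<Sum>b\<in>Basis. ?D x b *\<^sub>R b"
  have "Ck_on (Suc 0) UNIV f" using assms by (simp add: smooth_on_def del: Ck_on.simps)
  note d = Ck_on_SucD[OF open_UNIV this]
  have G: "(f has_derivative (\<lambda>h. h \<bullet> ?G x)) (at x)" for x
  proof -
    have lin: "linear (?D x)" by (rule has_derivative_linear[OF d(1)[OF UNIV_I]])
    have "?D x h = h \<bullet> ?G x" for h
    proof -
      have "?D x h = ?D x (\<Sum>b\<in>Basis. (h \<bullet> b) *\<^sub>R b)" by (simp only: euclidean_representation)
      also have "\<dots> = (\<Sum>b\<in>Basis. (h \<bullet> b) * ?D x b)"
        by (simp only: linear_sum[OF lin] linear_cmul[OF lin] real_scaleR_def)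
      also have "\<dots> = h \<bullet> ?G x"
        by (simp only: inner_sum_right inner_scaleR_right mult.commute)
      finally show ?thesis .
    qed
    then have e: "?D x = (\<lambda>h. h \<bullet> ?G x)" by (rule ext)
    show ?thesis by (rule has_derivative_eq_rhs[OF d(1)[OF UNIV_I] e])
  qed
  have eq: "gradient f x = ?G x" for x by (rule gradient_eqI[OF G])
  show "(f has_derivative (\<lambda>h. h \<bullet> gradient f x)) (at x)" unfolding eq by (rule G)
  show "continuous_on UNIV (gradient f)"
    unfolding eq[abs_def] using d(2) by (auto intro!: continuous_intros)
qed

section \<open>The radial law and the Poincare inequality along rays\<close>

text \<open>This is the independence of \<open>|X|\<close> and \<open>X/|X|\<close>, with their distributions: the polar
  coordinates formula turns the density \<open>p (|x|)\<close> into the density \<open>\<sigma>\<^sub>n r\<^sup>n\<^sup>-\<^sup>1 p(r)\<close> for the length.\<close>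

lemma radial_law_eq_distr:
  fixes p :: "real \<Rightarrow> real"
  defines "\<nu> \<equiv> density lborel (\<lambda>r. ennreal (radial_density DIM('a) p r) * indicator {0<..} r)"
  assumes p: "\<And>r. 0 \<le> r \<Longrightarrow> 0 \<le> p r"
    and [measurable]: "(\<lambda>x::'a. ennreal (p (norm x))) \<in> borel_measurable borel"
    and [measurable]: "(\<lambda>r. ennreal (radial_density DIM('a) p r) * indicator {0<..} r) \<in> borel_measurable borel"
  shows "density lborel (\<lambda>x::'a::euclidean_space. ennreal (p (norm x)))
    = distr (\<nu> \<Otimes>\<^sub>M gauss) borel (\<lambda>q. fst q *\<^sub>R sgn (snd q))"
proof (rule measure_eqI)
  interpret B: prob_space "gauss :: 'a measure" by (rule prob_space_gauss)
  let ?n = "DIM('a)"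
  have s\<nu>[measurable_cong]: "sets \<nu> = sets borel" by (simp add: \<nu>_def)
  have \<sigma>: "0 \<le> unit_sphere_area ?n" by (simp add: unit_sphere_area_eq)
  fix A assume "A \<in> sets (density lborel (\<lambda>x::'a. ennreal (p (norm x))))"
  then have A[measurable]: "A \<in> sets borel" by simp
  have "emeasure (density lborel (\<lambda>x::'a. ennreal (p (norm x)))) A = (\<integral>\<^sup>+x. ennreal (p (norm x)) * indicator A x \<partial>lborel)"
    by (simp add: emeasure_density)
  also have "\<dots> = (\<integral>\<^sup>+\<rho>. ennreal (unit_sphere_area ?n * \<rho> ^ (?n - 1)) * indicator {0<..} \<rho> *
        (\<integral>\<^sup>+z. ennreal (p (norm (\<rho> *\<^sub>R sgn z))) * indicator A (\<rho> *\<^sub>R sgn z) \<partial>gauss) \<partial>lborel)"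
    by (rule nn_integral_polar_gauss) measurable
  also have "\<dots> = (\<integral>\<^sup>+\<rho>. ennreal (radial_density ?n p \<rho>) * indicator {0<..} \<rho> * (\<integral>\<^sup>+z. indicator A (\<rho> *\<^sub>R sgn z) \<partial>(gauss :: 'a measure)) \<partial>lborel)"
  proof (rule nn_integral_cong)
    fix \<rho> :: real
    show "ennreal (unit_sphere_area ?n * \<rho> ^ (?n - 1)) * indicator {0<..} \<rho> *
        (\<integral>\<^sup>+z. ennreal (p (norm (\<rho> *\<^sub>R sgn z))) * indicator A (\<rho> *\<^sub>R sgn z) \<partial>gauss)
      = ennreal (radial_density ?n p \<rho>) * indicator {0<..} \<rho> * (\<integral>\<^sup>+z. indicator A (\<rho> *\<^sub>R sgn z) \<partial>(gauss :: 'a measure))"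
    proof (cases "\<rho> > 0")
      case True
      have "(\<integral>\<^sup>+z. ennreal (p (norm (\<rho> *\<^sub>R sgn z))) * indicator A (\<rho> *\<^sub>R sgn z) \<partial>gauss)
          = (\<integral>\<^sup>+z. ennreal (p \<rho>) * indicator A (\<rho> *\<^sub>R sgn z) \<partial>gauss)"
        by (rule nn_integral_cong_AE, use AE_gauss[OF AE_lborel_singleton[of 0]] in eventually_elim)
           (use True in \<open>simp add: norm_sgn\<close>)
      also have "\<dots> = ennreal (p \<rho>) * (\<integral>\<^sup>+z. indicator A (\<rho> *\<^sub>R sgn z) \<partial>gauss)"
        by (rule nn_integral_cmult) measurable
      finally show ?thesis
        using True p[of \<rho>] \<sigma> by (simp add: radial_density_def ennreal_mult' mult.assoc)
    qed simp
  qed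
  also have "\<dots> = (\<integral>\<^sup>+\<rho>. \<integral>\<^sup>+z. indicator A (fst (\<rho>, z) *\<^sub>R sgn (snd (\<rho>, z))) \<partial>gauss \<partial>\<nu>)"
    unfolding \<nu>_def by (subst nn_integral_density) auto
  also have "\<dots> = (\<integral>\<^sup>+q. indicator A (fst q *\<^sub>R sgn (snd q)) \<partial>(\<nu> \<Otimes>\<^sub>M gauss))"
    by (rule B.nn_integral_fst) measurable
  also have "\<dots> = (\<integral>\<^sup>+x. indicator A x \<partial>distr (\<nu> \<Otimes>\<^sub>M gauss) borel (\<lambda>q. fst q *\<^sub>R sgn (snd q)))"
    by (rule nn_integral_distr[symmetric]) measurable
  finally show "emeasure (density lborel (\<lambda>x::'a. ennreal (p (norm x)))) A
      = emeasure (distr (\<nu> \<Otimes>\<^sub>M gauss) borel (\<lambda>q. fst q *\<^sub>R sgn (snd q))) A" by simp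
qed simp

lemma (in prob_space) nn_variance_eq:
  fixes h :: "'a \<Rightarrow> real"
  assumes [measurable]: "h \<in> borel_measurable M" and C: "\<And>x. \<bar>h x\<bar> \<le> C"
  shows "(\<integral>\<^sup>+x. ennreal ((h x - (\<integral>x. h x \<partial>M))\<^sup>2) \<partial>M) = ennreal ((\<integral>x. (h x)\<^sup>2 \<partial>M) - (\<integral>x. h x \<partial>M)\<^sup>2)"
proof -
  have i: "integrable M h" by (rule integrable_bounded_by) (auto intro: C)
  have "\<bar>(h x)\<^sup>2\<bar> \<le> C\<^sup>2" for x using C[of x] by (simp add: abs_le_square_iff[symmetric])
  then have i2: "integrable M (\<lambda>x. (h x)\<^sup>2)" by (intro integrable_bounded_by) simp_all
  have "integrable M (\<lambda>x. (h x - (\<integral>x. h x \<partial>M))\<^sup>2)"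
    unfolding power2_diff using i i2 by simp
  then show ?thesis by (subst nn_integral_eq_integral) (simp_all add: variance_eq[OF i i2])
qed

text \<open>The one-dimensional inequality for \<open>r \<mapsto> \<psi> (r \<theta>)\<close>, rewritten for the measure with density \<open>f\<close>.
  The weight \<open>W\<close> extends \<open>w\<close> to a Borel function on the real line.\<close>

lemma poincare_on_ray:
  fixes \<psi> :: "'a::euclidean_space \<Rightarrow> real" and g :: "'a \<Rightarrow> 'a" and f w :: "real \<Rightarrow> real"
  defines "\<nu> \<equiv> density lborel (\<lambda>r. ennreal (f r) * indicator {0<..} r)"
  assumes N: "prob_space N" and wp: "weighted_poincare N Y f {0<..} w"
    and f0: "\<And>r. 0 < r \<Longrightarrow> 0 \<le> f r" and w0: "\<And>r. 0 < r \<Longrightarrow> 0 \<le> w r"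
    and W[measurable]: "W \<in> borel_measurable borel" and Ww: "\<And>r. 0 < r \<Longrightarrow> W r = w r"
    and \<psi>: "smooth_on UNIV \<psi>" and C: "\<And>x. \<bar>\<psi> x\<bar> \<le> C"
  shows "ennreal ((\<integral>r. (\<psi> (r *\<^sub>R \<theta>))\<^sup>2 \<partial>\<nu>) - (\<integral>r. \<psi> (r *\<^sub>R \<theta>) \<partial>\<nu>)\<^sup>2)
        \<le> (\<integral>\<^sup>+r. ennreal (W r * (\<theta> \<bullet> gradient \<psi> (r *\<^sub>R \<theta>))\<^sup>2) \<partial>\<nu>)"
    and "prob_space \<nu>"
proof -
  let ?dens = "\<lambda>r. ennreal (f r) * indicator {0<..} r"
  let ?h = "\<lambda>r. \<psi> (r *\<^sub>R \<theta>)"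
  have dist: "distributed N lborel Y ?dens" using wp by (simp add: weighted_poincare_def)
  have [measurable]: "?dens \<in> borel_measurable borel"
    using distributed_borel_measurable[OF dist] by simp
  have \<nu>Y: "\<nu> = distr N lborel Y" unfolding \<nu>_def using dist by (simp add: distributed_distr_eq_density)
  show prob: "prob_space \<nu>"
    unfolding \<nu>Y by (rule prob_space.prob_space_distr[OF N distributed_measurable[OF dist]])
  interpret A: prob_space \<nu> by (rule prob)
  have s\<nu>[measurable_cong]: "sets \<nu> = sets borel" by (simp add: \<nu>_def)
  note der = smooth_gradient(1)[OF \<psi>] and cont = smooth_gradient(2)[OF \<psi>]
  have "continuous_on UNIV \<psi>"
    by (intro continuous_at_imp_continuous_on ballI has_derivative_continuous[OF der])
  then have [measurable]: "\<psi> \<in> borel_measurable borel" by (rule borel_measurable_continuous_onI)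
  have [measurable]: "gradient \<psi> \<in> borel_measurable borel" using cont by (rule borel_measurable_continuous_onI)
  define fr where "fr r = indicator {0<..} r * f r" for r
  have fr0: "0 \<le> fr r" for r using f0[of r] by (simp add: fr_def split: split_indicator)
  have fr: "?dens r = ennreal (fr r)" for r by (simp add: fr_def split: split_indicator)
  have "fr = (\<lambda>r. enn2real (?dens r))" unfolding fr using fr0 by (simp add: fun_eq_iff)
  then have [measurable]: "fr \<in> borel_measurable borel" by simp
  have \<nu>fr: "\<nu> = density lborel (\<lambda>r. ennreal (fr r))" by (simp add: \<nu>_def fr)
  have nn: "(\<integral>\<^sup>+r\<in>{0<..}. ennreal (k r * f r) \<partial>lborel) = (\<integral>\<^sup>+r. ennreal (k' r) \<partial>\<nu>)"
    if [measurable]: "k' \<in> borel_measurable borel" and k: "\<And>r. 0 < r \<Longrightarrow> 0 \<le> k r \<and> k' r = k r" for k k'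
    unfolding \<nu>fr
    by (subst nn_integral_density)
       (simp_all, auto intro!: nn_integral_cong simp: fr_def ennreal_mult'[symmetric] k f0 mult.commute split: split_indicator)
  have mean: "(LINT r:{0<..}|lborel. ?h r * f r) = (\<integral>r. ?h r \<partial>\<nu>)"
    unfolding \<nu>fr set_lebesgue_integral_def
    by (subst integral_density) (simp_all add: fr0, simp add: fr_def mult_ac)
  have d: "(?h has_real_derivative (\<theta> \<bullet> gradient \<psi> (r *\<^sub>R \<theta>))) (at r)" for r
  proof -
    have "((\<lambda>r. r *\<^sub>R \<theta>) has_derivative (\<lambda>h. h *\<^sub>R \<theta>)) (at r)" by (auto intro!: derivative_eq_intros)
    from has_derivative_compose[OF this der]
    show ?thesis by (simp add: has_field_derivative_def mult.commute[of _ "\<theta> \<bullet> gradient \<psi> (r *\<^sub>R \<theta>)"])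
  qed
  have "smooth_on {0<..} ?h" by (rule smooth_on_ray[OF \<psi>]) simp
  moreover have "bounded (?h ` {0<..})" unfolding bounded_iff using C by auto
  ultimately have "(\<integral>\<^sup>+r\<in>{0<..}. ennreal ((?h r - (LINT y:{0<..}|lborel. ?h y * f y))\<^sup>2 * f r) \<partial>lborel)
          \<le> (\<integral>\<^sup>+r\<in>{0<..}. ennreal (w r * (deriv ?h r)\<^sup>2 * f r) \<partial>lborel)"
    using wp by (auto simp: weighted_poincare_def)
  also have "\<dots> = (\<integral>\<^sup>+r. ennreal (W r * (\<theta> \<bullet> gradient \<psi> (r *\<^sub>R \<theta>))\<^sup>2) \<partial>\<nu>)"
    by (intro nn) (auto simp: DERIV_imp_deriv[OF d] Ww w0)
  also have "(\<integral>\<^sup>+r\<in>{0<..}. ennreal ((?h r - (LINT y:{0<..}|lborel. ?h y * f y))\<^sup>2 * f r) \<partial>lborel)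
      = (\<integral>\<^sup>+r. ennreal ((?h r - (\<integral>r. ?h r \<partial>\<nu>))\<^sup>2) \<partial>\<nu>)"
    unfolding mean by (intro nn) auto
  also have "\<dots> = ennreal ((\<integral>r. (?h r)\<^sup>2 \<partial>\<nu>) - (\<integral>r. ?h r \<partial>\<nu>)\<^sup>2)"
    by (rule A.nn_variance_eq[OF _ C]) measurable
  finally show "ennreal ((\<integral>r. (?h r)\<^sup>2 \<partial>\<nu>) - (\<integral>r. ?h r \<partial>\<nu>)\<^sup>2)
        \<le> (\<integral>\<^sup>+r. ennreal (W r * (\<theta> \<bullet> gradient \<psi> (r *\<^sub>R \<theta>))\<^sup>2) \<partial>\<nu>)" .
qed

section \<open>The weighted Poincare inequality for radial densities\<close>

lemma scaled_sin_tendsto: "(\<lambda>k. real (Suc k) * sin (1 / real (Suc k) * y)) \<longlonglongrightarrow> y"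
proof -
  have "((\<lambda>t. sin (t * y)) has_real_derivative y) (at 0)"
    by (auto intro!: derivative_eq_intros)
  then have "((\<lambda>t. sin (t * y) / t) \<longlongrightarrow> y) (at 0)" by (simp add: DERIV_def)
  moreover have "filterlim (\<lambda>k. inverse (real (Suc k))) (at 0) sequentially"
    by (intro filterlim_atI LIMSEQ_inverse_real_of_nat) simp
  ultimately have "(\<lambda>k. sin (inverse (real (Suc k)) * y) / inverse (real (Suc k))) \<longlonglongrightarrow> y"
    by (rule filterlim_compose)
  then show ?thesis by (simp add: inverse_eq_divide mult.commute del: of_nat_Suc)
qed

lemma abs_scaled_sin_le: "c > 0 \<Longrightarrow> \<bar>c * sin (1 / c * y)\<bar> \<le> \<bar>y :: real\<bar>"
  using abs_sin_x_le_abs_x[of "y / c"] by (simp add: abs_mult field_simps)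

theorem theorem10:
  fixes M :: "'a measure" and N :: "'b measure"
    and X :: "'a \<Rightarrow> real ^ 'n" and Y :: "'b \<Rightarrow> real"
    and finf w :: "real \<Rightarrow> real"
    and \<phi> :: "real ^ 'n \<Rightarrow> real"
  assumes "CARD('n) \<ge> 2"
    and "prob_space M" and "prob_space N"
    and "\<And>r. 0 \<le> r \<Longrightarrow> 0 \<le> finf r"
    and "distributed M lborel X (\<lambda>x. ennreal (finf (norm x)))"
    and "w \<in> borel_measurable (restrict_space borel {0<..})"
    and "\<And>r. 0 < r \<Longrightarrow> 0 \<le> w r"
    and "weighted_poincare N Y (radial_density CARD('n) finf) {0<..} w"
    and "smooth_on UNIV \<phi>"
    and "(\<integral>\<^sup>+x. ennreal ((\<phi> x - (\<integral>y. \<phi> y * finf (norm y) \<partial>lborel))\<^sup>2 * finf (norm x)) \<partial>lborel) < \<infinity>"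
  shows "ennreal ((\<integral>x. (\<phi> x)\<^sup>2 * finf (norm x) \<partial>lborel) - (\<integral>y. \<phi> y * finf (norm y) \<partial>lborel)\<^sup>2)
    \<le> (\<integral>\<^sup>+x. ennreal (max (w (norm x)) (pi\<^sup>2 / 2 * (norm x)\<^sup>2) * (norm (gradient \<phi> x))\<^sup>2 * finf (norm x)) \<partial>lborel)"
proof -
  note n = assms(1) and finf0 = assms(4) and X = assms(5) and w0 = assms(7) and wp = assms(8) and \<phi> = assms(9)
  have DIM: "DIM(real ^ 'n) = CARD('n)" by simp
  let ?f = "radial_density DIM(real ^ 'n) finf"
  let ?dens = "\<lambda>r. ennreal (?f r) * indicator {0<..} r"
  define \<nu> where "\<nu> = density lborel ?dens"
  define L where "L = density lborel (\<lambda>x::real ^ 'n. ennreal (finf (norm x)))"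
  define W where "W r = indicator {0<..} r *\<^sub>R w r" for r
  note wp' = wp[folded DIM]
  have finf_m[measurable]: "(\<lambda>x::real ^ 'n. ennreal (finf (norm x))) \<in> borel_measurable borel"
    using distributed_borel_measurable[OF X] by simp
  have dens_l: "?dens \<in> borel_measurable lborel"
    by (rule distributed_borel_measurable[OF conjunct1[OF wp'[unfolded weighted_poincare_def]]])
  then have dens_m[measurable]: "?dens \<in> borel_measurable borel"
    by simp
  have [measurable]: "(\<lambda>x::real ^ 'n. finf (norm x)) \<in> borel_measurable borel"
  proof -
    have "(\<lambda>x::real ^ 'n. finf (norm x)) = (\<lambda>x. enn2real (ennreal (finf (norm x))))"
      by (simp add: fun_eq_iff finf0)
    then show ?thesis by (metis (no_types) borel_measurable_enn2real finf_m)
  qed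
  have W[measurable]: "W \<in> borel_measurable borel"
    using assms(6) borel_measurable_restrict_space_iff[of "{0<..}" borel w]
    unfolding W_def[abs_def] by simp
  have Ww: "W r = w r" if "0 < r" for r using that by (simp add: W_def)
  have W0: "0 \<le> W r" for r using w0[of r] by (simp add: W_def split: split_indicator)
  have f0: "0 \<le> ?f r" if "0 < r" for r
    using that finf0[of r] by (simp add: radial_density_def unit_sphere_area_eq)
  have sL[measurable_cong]: "sets L = sets borel" by (simp add: L_def)
  have LX: "L = distr M lborel X" unfolding L_def using X by (simp add: distributed_distr_eq_density)
  have probL: "prob_space L"
    unfolding LX by (rule prob_space.prob_space_distr[OF assms(2) distributed_measurable[OF X]])
  interpret L: prob_space L by (rule probL)
  have LD: "L = distr (\<nu> \<Otimes>\<^sub>M gauss) borel (\<lambda>q. fst q *\<^sub>R sgn (snd q))"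
    unfolding L_def \<nu>_def by (rule radial_law_eq_distr[OF finf0 finf_m dens_m])
  have \<nu>pos: "AE r in \<nu>. 0 < r"
    unfolding \<nu>_def AE_density[OF dens_l] by (rule AE_I2) (simp split: split_indicator)
  have L_int: "(\<integral>x. k x \<partial>L) = (\<integral>x. k x * finf (norm x) \<partial>lborel)"
    if [measurable]: "k \<in> borel_measurable borel" for k :: "real ^ 'n \<Rightarrow> real"
    unfolding L_def by (subst integral_density) (auto simp: finf0 mult.commute)
  have L_nn: "(\<integral>\<^sup>+x. ennreal (k x) \<partial>L) = (\<integral>\<^sup>+x. ennreal (k x * finf (norm x)) \<partial>lborel)"
    if [measurable]: "k \<in> borel_measurable borel" and "\<And>x. 0 \<le> k x" for k :: "real ^ 'n \<Rightarrow> real"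
    unfolding L_def by (subst nn_integral_density) (auto simp: finf0 that ennreal_mult' mult.commute)
  note der = smooth_gradient(1)[OF \<phi>] and cont = smooth_gradient(2)[OF \<phi>]
  have "continuous_on UNIV \<phi>"
    by (intro continuous_at_imp_continuous_on ballI has_derivative_continuous[OF der])
  then have [measurable]: "\<phi> \<in> borel_measurable borel" by (rule borel_measurable_continuous_onI)
  have [measurable]: "gradient \<phi> \<in> borel_measurable borel" using cont by (rule borel_measurable_continuous_onI)
  let ?R = "\<integral>\<^sup>+x. ennreal (max (W (norm x)) (pi\<^sup>2 / 2 * (norm x)\<^sup>2) * (norm (gradient \<phi> x))\<^sup>2) \<partial>L"
  \<comment> \<open>bounded smooth approximations of \<open>\<phi>\<close>\<close>
  define \<psi> where "\<psi> k x = real (Suc k) * sin (1 / real (Suc k) * \<phi> x)" for k x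
  have bounded_case: "ennreal ((\<integral>x. (\<psi> k x)\<^sup>2 \<partial>L) - (\<integral>x. \<psi> k x \<partial>L)\<^sup>2) \<le> ?R" for k
  proof -
    have smooth: "smooth_on UNIV (\<psi> k)" unfolding \<psi>_def by (rule smooth_on_sin_scaled[OF \<phi> open_UNIV])
    have C: "\<bar>\<psi> k x\<bar> \<le> real (Suc k)" for x
    proof -
      have "real (Suc k) * \<bar>sin (1 / real (Suc k) * \<phi> x)\<bar> \<le> real (Suc k) * 1"
        by (rule mult_left_mono[OF abs_sin_le_one]) simp
      then show ?thesis by (simp add: \<psi>_def abs_mult del: of_nat_Suc)
    qed
    note ray = poincare_on_ray[OF assms(3) wp' f0 w0 W Ww smooth C, folded \<nu>_def]
    have "ennreal ((\<integral>x. (\<psi> k x)\<^sup>2 \<partial>L) - (\<integral>x. \<psi> k x \<partial>L)\<^sup>2)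
      \<le> (\<integral>\<^sup>+x. ennreal (max (W (norm x)) (pi\<^sup>2 / 2 * (norm x)\<^sup>2) * (norm (gradient (\<psi> k) x))\<^sup>2) \<partial>L)"
      by (rule variance_radial_le[OF ray(2) _ \<nu>pos smooth_gradient(1)[OF smooth] smooth_gradient(2)[OF smooth] C _ W W0 ray(1) LD])
         (simp_all add: \<nu>_def n)
    also have "\<dots> \<le> ?R"
    proof (intro nn_integral_mono ennreal_leI mult_left_mono)
      fix x :: "real ^ 'n"
      have "(\<psi> k has_derivative (\<lambda>h. h \<bullet> (cos (1 / real (Suc k) * \<phi> x) *\<^sub>R gradient \<phi> x))) (at x)"
        unfolding \<psi>_def by (rule derivative_eq_intros der refl | simp add: mult.commute del: of_nat_Suc)+
      then have "gradient (\<psi> k) x = cos (1 / real (Suc k) * \<phi> x) *\<^sub>R gradient \<phi> x" by (rule gradient_eqI)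
      then have "norm (gradient (\<psi> k) x) \<le> norm (gradient \<phi> x)"
        by (simp add: mult_left_le_one_le del: of_nat_Suc)
      then show "(norm (gradient (\<psi> k) x))\<^sup>2 \<le> (norm (gradient \<phi> x))\<^sup>2" by (rule power_mono) simp
      show "0 \<le> max (W (norm x)) (pi\<^sup>2 / 2 * (norm x)\<^sup>2)" using W0[of "norm x"] by simp
    qed
    finally show ?thesis .
  qed
  have RHS: "?R = (\<integral>\<^sup>+x. ennreal (max (w (norm x)) (pi\<^sup>2 / 2 * (norm x)\<^sup>2) * (norm (gradient \<phi> x))\<^sup>2 * finf (norm x)) \<partial>lborel)"
  proof -
    have "?R = (\<integral>\<^sup>+x. ennreal (max (W (norm x)) (pi\<^sup>2 / 2 * (norm x)\<^sup>2) * (norm (gradient \<phi> x))\<^sup>2 * finf (norm x)) \<partial>lborel)"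
      using W0 by (intro L_nn) (auto simp: le_max_iff_disj)
    also have "\<dots> = (\<integral>\<^sup>+x. ennreal (max (w (norm x)) (pi\<^sup>2 / 2 * (norm x)\<^sup>2) * (norm (gradient \<phi> x))\<^sup>2 * finf (norm x)) \<partial>lborel)"
      by (rule nn_integral_cong_AE, use AE_lborel_singleton[of 0] in eventually_elim) (simp add: Ww)
    finally show ?thesis .
  qed
  have "integrable L (\<lambda>x. (\<phi> x - (\<integral>y. \<phi> y * finf (norm y) \<partial>lborel))\<^sup>2)"
    using assms(10) by (intro integrableI_bounded) (simp_all add: L_nn)
  then have "integrable L (\<lambda>x. \<phi> x - (\<integral>y. \<phi> y * finf (norm y) \<partial>lborel))"
    and sq: "integrable L (\<lambda>x. (\<phi> x - (\<integral>y. \<phi> y * finf (norm y) \<partial>lborel))\<^sup>2)"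
    by (auto intro!: L.square_integrable_imp_integrable)
  then have "integrable L (\<lambda>x. \<phi> x - (\<integral>y. \<phi> y * finf (norm y) \<partial>lborel) + (\<integral>y. \<phi> y * finf (norm y) \<partial>lborel))"
    by (intro Bochner_Integration.integrable_add) auto
  then have i1: "integrable L \<phi>" by simp
  let ?m = "\<integral>y. \<phi> y * finf (norm y) \<partial>lborel"
  have "integrable L (\<lambda>x. (\<phi> x - ?m)\<^sup>2 + 2 * ?m * \<phi> x - ?m\<^sup>2)" using sq i1 by simp
  then have i2: "integrable L (\<lambda>x. (\<phi> x)\<^sup>2)" by (simp add: power2_diff algebra_simps)
  have [measurable]: "\<psi> k \<in> borel_measurable borel" for k unfolding \<psi>_def by measurable
  have le: "\<bar>\<psi> k x\<bar> \<le> \<bar>\<phi> x\<bar>" for k x unfolding \<psi>_def by (rule abs_scaled_sin_le) simp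
  have lim: "(\<lambda>k. \<psi> k x) \<longlonglongrightarrow> \<phi> x" for x unfolding \<psi>_def by (rule scaled_sin_tendsto)
  have "(\<lambda>k. \<integral>x. \<psi> k x \<partial>L) \<longlonglongrightarrow> (\<integral>x. \<phi> x \<partial>L)"
    using i1 le lim by (intro integral_dominated_convergence[where w = "\<lambda>x. \<bar>\<phi> x\<bar>"]) auto
  moreover have "(\<lambda>k. \<integral>x. (\<psi> k x)\<^sup>2 \<partial>L) \<longlonglongrightarrow> (\<integral>x. (\<phi> x)\<^sup>2 \<partial>L)"
    using i2 le lim by (intro integral_dominated_convergence[where w = "\<lambda>x. (\<phi> x)\<^sup>2"])
      (auto intro!: tendsto_intros simp: abs_le_square_iff)
  ultimately have "(\<lambda>k. ennreal ((\<integral>x. (\<psi> k x)\<^sup>2 \<partial>L) - (\<integral>x. \<psi> k x \<partial>L)\<^sup>2))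
      \<longlonglongrightarrow> ennreal ((\<integral>x. (\<phi> x)\<^sup>2 \<partial>L) - (\<integral>x. \<phi> x \<partial>L)\<^sup>2)"
    by (intro tendsto_intros)
  then have "ennreal ((\<integral>x. (\<phi> x)\<^sup>2 \<partial>L) - (\<integral>x. \<phi> x \<partial>L)\<^sup>2) \<le> ?R"
    by (rule LIMSEQ_le_const2) (use bounded_case in blast)
  then show ?thesis unfolding RHS by (simp add: L_int)
qed

end
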